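(* $$\lim_{n\to\infty}\frac1n\cdot\frac{1}{\mathrm{Cat}_n^2}\sum_{\sigma,\rho\in\mathrm{NC}(n)}\bigl(|\sigma|+|\rho|-2|\sigma\vee\rho|\bigr)=\frac{3\pi-8}{8-2\pi}<0.83,$$ where on the right-hand side $\pi=3.14159\ldots$ is the usual constant.
   Context: For a positive integer $n$, a partition $\sigma$ of $\{1,\ldots,n\}$ is non-crossing if there are no two distinct blocks $V,W$ of $\sigma$ and numbers $a<b<c<d$ with $a,c\in V$ and $b,d\in W$. $\mathrm{NC}(n)$ is the set of non-crossing partitions of $\{1,\ldots,n\}$, partially ordered by $\sigma\le\rho$ iff every block of $\sigma$ is contained in a block of $\rho$; this partially ordered set is a lattice, and $\sigma\vee\rho$ denotes the join (least common upper bound) of $\sigma,\rho$ in $\mathrm{NC}(n)$. $|\sigma|$ is the number of blocks of $\sigma$. $\mathrm{Cat}_n=\frac{(2n)!}{n!(n+1)!}=|\mathrm{NC}(n)|$ is the $n$th Catalan number. *)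

theory Defs
  imports "HOL-Analysis.Analysis" "HOL-Library.Disjoint_Sets"
begin

definition noncrossing :: "nat set set \<Rightarrow> bool" where
  "noncrossing \<sigma> \<longleftrightarrow>
     \<not> (\<exists>V\<in>\<sigma>. \<exists>W\<in>\<sigma>. V \<noteq> W \<and>
          (\<exists>a b c d. a < b \<and> b < c \<and> c < d \<and> a \<in> V \<and> c \<in> V \<and> b \<in> W \<and> d \<in> W))"

definition NC :: "nat \<Rightarrow> nat set set set" where
  "NC n = {\<sigma>. partition_on {1..n} \<sigma> \<and> noncrossing \<sigma>}"

(* The order on NC n is the library's refinement relation: for partitions of {1..n},
   refines {1..n} \<sigma> \<rho> says that every block of \<sigma> is contained in a block of \<rho>. *)

definition is_NC_join ::
  "nat \<Rightarrow> nat set set \<Rightarrow> nat set set \<Rightarrow> nat set set \<Rightarrow> bool" where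
  "is_NC_join n \<sigma> \<rho> \<tau> \<longleftrightarrow>
     \<tau> \<in> NC n \<and> refines {1..n} \<sigma> \<tau> \<and> refines {1..n} \<rho> \<tau> \<and>
     (\<forall>\<upsilon>\<in>NC n. refines {1..n} \<sigma> \<upsilon> \<and> refines {1..n} \<rho> \<upsilon> \<longrightarrow> refines {1..n} \<tau> \<upsilon>)"

(* Since NC n is a lattice, the description is proper whenever \<sigma> and \<rho> are in NC n. This is
   the join in NC n, which may be strictly coarser than the join among all partitions of {1..n}. *)
definition NC_join :: "nat \<Rightarrow> nat set set \<Rightarrow> nat set set \<Rightarrow> nat set set" where
  "NC_join n \<sigma> \<rho> = (THE \<tau>. is_NC_join n \<sigma> \<rho> \<tau>)"

definition Cat :: "nat \<Rightarrow> real" where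
  "Cat n = fact (2 * n) / (fact n * fact (n + 1))"

end

(* A number a is the minimum of a block of the join of sigma and rho iff some interval {a..b} is
   saturated, that is, a union of blocks of sigma and a union of blocks of rho.  Cutting out the
   shortest such interval gives, with M the generating function of the squared Catalan numbers and U
   that of the pairs on {1..k} for which no proper initial segment is saturated,
     M = 1 + U M   and   sum over n and (sigma, rho) of |join| z^n = U (z M)'.
   Dividing by n Cat_n^2 and letting n tend to infinity, the second product is governed by the
   coefficients of (z M)', which are regular of order 16^n / n^2, while those of U are O(16^n / n^3).
   So the mean of |join| / n tends to U(1/16) = 1 - 1 / M(1/16).  The series M(1/16) telescopes:
   Cat_n^2 / 16^n is the difference of 4 (4 n + 1) t_n^2 with t_n = binom(2 n, n) / 4^n, and the
   Wallis product gives M(1/16) = 16 / pi - 4.  The same decomposition for a single partition gives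
   |NC(n)| = Cat_n and the mean number (n + 1) / 2 of blocks. *)
theory Submission
  imports Defs
begin

text \<open>The join is not computed; it enters only through its least upper bound property. For an
  interval I, the partition into I and its complement is non-crossing, and if I is saturated for
  sigma and rho it lies above both, hence above the join. Conversely, the hull of a block of a
  non-crossing partition is saturated. So the number of blocks of the join becomes a statistic of
  the pair. The irreducible pairs are known only through M = 1 + U M. As all coefficients are
  nonnegative, this bounds those of U by those of M, which is the source of the order 16^n / n^3.
  Both factors of U (z M)' converge at 1/16, and heuristically the n-th coefficient of the product
  is U(1/16) b_n + B(1/16) u_n, where B = (z M)' has coefficients b_n and U has coefficients u_n. As
  u_n / b_n = O(1/n), only the first summand survives. With mean n/2 for |sigma| and for |rho|, the
  limit is 1 - 2 U(1/16).\<close>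

section \<open>Noncrossing partitions and their joins\<close>

text \<open>The ground set is arbitrary because cutting out an interval leaves a set with a
  gap.\<close>

definition NC_on :: "nat set \<Rightarrow> nat set set set" where
  "NC_on A = {\<sigma>. partition_on A \<sigma> \<and> noncrossing \<sigma>}"

definition saturated :: "nat set \<Rightarrow> nat set set \<Rightarrow> bool" where
  "saturated I \<sigma> \<longleftrightarrow> (\<forall>B\<in>\<sigma>. B \<subseteq> I \<or> B \<inter> I = {})"

lemma NC_eq_NC_on: "NC n = NC_on {1..n}"
  by (simp add: NC_def NC_on_def)

lemma noncrossingD:
  assumes "noncrossing \<sigma>" "V \<in> \<sigma>" "W \<in> \<sigma>" "a < b" "b < c" "c < d"
    "a \<in> V" "c \<in> V" "b \<in> W" "d \<in> W"
  shows "V = W"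
proof (rule ccontr)
  assume "V \<noteq> W"
  moreover have "\<exists>a b c d. a < b \<and> b < c \<and> c < d \<and> a \<in> V \<and> c \<in> V \<and> b \<in> W \<and> d \<in> W"
    using assms(4-10) by blast
  ultimately have "\<not> noncrossing \<sigma>"
    unfolding noncrossing_def not_not using assms(2,3) by (intro bexI conjI)
  then show False using assms(1) by contradiction
qed

lemma noncrossingI:
  assumes "\<And>V W a b c d. V \<in> \<sigma> \<Longrightarrow> W \<in> \<sigma> \<Longrightarrow> a < b \<Longrightarrow> b < c \<Longrightarrow> c < d \<Longrightarrow>
    a \<in> V \<Longrightarrow> c \<in> V \<Longrightarrow> b \<in> W \<Longrightarrow> d \<in> W \<Longrightarrow> V = W"
  shows "noncrossing \<sigma>"
  using assms unfolding noncrossing_def by blast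

lemma NC_onD:
  assumes "\<sigma> \<in> NC_on A"
  shows "partition_on A \<sigma>" "noncrossing \<sigma>" "\<Union>\<sigma> = A" "{} \<notin> \<sigma>"
  using assms by (auto simp: NC_on_def partition_on_def)

lemma NC_on_block_eq:
  assumes "\<sigma> \<in> NC_on A" "V \<in> \<sigma>" "W \<in> \<sigma>" "x \<in> V" "x \<in> W"
  shows "V = W"
  using assms unfolding NC_on_def partition_on_def disjoint_def by blast

lemma finite_NC_on: "finite A \<Longrightarrow> finite (NC_on A)"
  using finitely_many_partition_on[of A] by (auto simp: NC_on_def)

lemma NC_on_empty: "NC_on {} = {{}}"
  by (auto simp: NC_on_def partition_on_empty noncrossing_def)

text \<open>A block of the common refinement is an intersection of one block from each
  \<open>P\<close>. If two such intersections crossed, the chosen blocks would cross in every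
  \<open>P\<close>, so all the choices agree.\<close>

lemma NC_on_common_refinement:
  assumes "\<P> \<noteq> {}" and P: "\<And>P. P \<in> \<P> \<Longrightarrow> P \<in> NC_on A"
  shows "common_refinement \<P> \<in> NC_on A"
proof -
  have part: "partition_on A (common_refinement \<P>)"
    using assms by (intro partition_on_common_refinement) (auto dest: NC_onD)
  have "noncrossing (common_refinement \<P>)"
  proof (rule noncrossingI)
    fix V W a b c d
    assume V: "V \<in> common_refinement \<P>" and W: "W \<in> common_refinement \<P>"
      and lt: "a < b" "b < c" "c < d" and mem: "a \<in> V" "c \<in> V" "b \<in> W" "d \<in> W"
    obtain f where f: "f \<in> (\<Pi> P\<in>\<P>. P)" "V = \<Inter> (f ` \<P>)" 
      using V by (auto simp: common_refinement)
    obtain g where g: "g \<in> (\<Pi> P\<in>\<P>. P)" "W = \<Inter> (g ` \<P>)" 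
      using W by (auto simp: common_refinement)
    have "f P = g P" if "P \<in> \<P>" for P
      using noncrossingD[of P "f P" "g P" a b c d] NC_onD(2)[OF P[OF that]] that f g lt mem by auto
    then show "V = W" using f g by auto
  qed
  then show ?thesis using part by (simp add: NC_on_def)
qed

text \<open>As non-crossing partitions are closed under meets, the join is the meet of all
  non-crossing upper bounds; the one-block partition shows that there are some.\<close>

lemma ex_NC_join:
  assumes "\<sigma> \<in> NC n" "\<rho> \<in> NC n"
  shows "\<exists>!\<tau>. is_NC_join n \<sigma> \<rho> \<tau>"
proof -
  define \<P> where "\<P> = {\<upsilon>\<in>NC n. refines {1..n} \<sigma> \<upsilon> \<and> refines {1..n} \<rho> \<upsilon>}"
  \<comment> \<open>The empty set has only the empty partition, since {} is never a block.\<close>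
  define top where "top = (if n = 0 then {} else {{1..n}})"
  have top_part: "partition_on {1..n} top"
    by (auto simp: top_def partition_on_empty partition_on_space)
  have "top \<in> NC n"
    using top_part by (auto simp: NC_def noncrossing_def top_def)
  moreover have "refines {1..n} \<upsilon> top" if "\<upsilon> \<in> NC n" for \<upsilon>
    using that top_part unfolding refines_def NC_def
    by (auto simp: top_def partition_on_def)
  ultimately have ne: "\<P> \<noteq> {}"
    using assms by (auto simp: \<P>_def)
  have part: "partition_on {1..n} P" if "P \<in> \<P>" for P
    using that by (auto simp: \<P>_def NC_def)
  have \<sigma>\<rho>: "partition_on {1..n} \<sigma>" "partition_on {1..n} \<rho>"
    using assms by (auto simp: NC_def)
  have join: "is_NC_join n \<sigma> \<rho> (common_refinement \<P>)"
    unfolding is_NC_join_def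
  proof (intro conjI ballI impI)
    show "common_refinement \<P> \<in> NC n"
      unfolding NC_eq_NC_on using ne by (rule NC_on_common_refinement) (auto simp: \<P>_def NC_eq_NC_on)
    show "refines {1..n} \<sigma> (common_refinement \<P>)" "refines {1..n} \<rho> (common_refinement \<P>)"
      using \<sigma>\<rho> ne part by (auto intro!: common_refinement_coarsest simp: \<P>_def)
    show "refines {1..n} (common_refinement \<P>) \<upsilon>"
      if "\<upsilon> \<in> NC n" "refines {1..n} \<sigma> \<upsilon> \<and> refines {1..n} \<rho> \<upsilon>" for \<upsilon>
      using that by (intro refines_common_refinement part) (auto simp: \<P>_def)
  qed
  then show ?thesis
  proof (rule ex1I)
    fix \<tau> assume "is_NC_join n \<sigma> \<rho> \<tau>"
    then show "\<tau> = common_refinement \<P>"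
      using join by (auto simp: is_NC_join_def intro!: refines_asym)
  qed
qed

lemma NC_join_is_join:
  assumes "\<sigma> \<in> NC n" "\<rho> \<in> NC n"
  shows "is_NC_join n \<sigma> \<rho> (NC_join n \<sigma> \<rho>)"
  unfolding NC_join_def using ex_NC_join[OF assms] by (rule theI')

section \<open>Blocks of a join and saturated intervals\<close>

text \<open>A block W other than V with a point c inside the hull of V and a point d outside would
  cross V: either Min V < c < Max V < d or d < Min V < c < Max V alternates between V and W.\<close>

lemma saturated_min_max_block:
  assumes "\<tau> \<in> NC_on {1..n}" "V \<in> \<tau>"
  shows "saturated {Min V..Max V} \<tau>"
  unfolding saturated_def
proof (intro ballI)
  fix W assume W: "W \<in> \<tau>"
  have V: "V \<subseteq> {1..n}" "V \<noteq> {}" "finite V"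
    using assms NC_onD[OF assms(1)] by (auto intro: finite_subset)
  have mm: "Min V \<in> V" "Max V \<in> V" using V by auto
  show "W \<subseteq> {Min V..Max V} \<or> W \<inter> {Min V..Max V} = {}"
  proof (cases "W = V")
    case True
    then show ?thesis using V by auto
  next
    case False
    have nV: "x \<noteq> Min V" "x \<noteq> Max V" if "x \<in> W" for x
      using NC_on_block_eq[OF assms(1) assms(2) W] mm that False by auto
    show ?thesis
    proof (rule ccontr)
      assume "\<not> ?thesis"
      then obtain c d where cd: "c \<in> W" "d \<in> W" "Min V \<le> c" "c \<le> Max V" "d < Min V \<or> Max V < d"
        by fastforce
      then have "Min V < c" "c < Max V" using nV by (metis le_neq_implies_less)+
      then show False
        using cd(5) noncrossingD[OF NC_onD(2)[OF assms(1)] assms(2) W, of "Min V" c "Max V" d]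
          noncrossingD[OF NC_onD(2)[OF assms(1)] W assms(2), of d "Min V" c "Max V"] mm cd False by auto
    qed
  qed
qed

lemma saturated_refines:
  assumes "refines A \<sigma> \<tau>" "saturated I \<tau>"
  shows "saturated I \<sigma>"
  unfolding saturated_def
proof
  fix B assume "B \<in> \<sigma>"
  then obtain C where "C \<in> \<tau>" "B \<subseteq> C" using assms(1) unfolding refines_def by meson
  moreover from this have "C \<subseteq> I \<or> C \<inter> I = {}" using assms(2) by (simp add: saturated_def)
  ultimately show "B \<subseteq> I \<or> B \<inter> I = {}" by auto
qed

text \<open>Supplies the upper bounds against which the join is tested. Two points of an interval
  enclose no point of its complement, so the two blocks cannot cross. Removing {} covers the case
  where the interval is all of {1..n}.\<close>

lemma interval_partition:
  assumes "1 \<le> a" "a \<le> b" "b \<le> n"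
  defines "\<upsilon> \<equiv> {{a..b}, {1..n} - {a..b}} - {{}}"
  shows "\<upsilon> \<in> NC_on {1..n}"
    and "partition_on {1..n} \<sigma> \<Longrightarrow> saturated {a..b} \<sigma> \<Longrightarrow> refines {1..n} \<sigma> \<upsilon>"
proof -
  have part: "partition_on {1..n} \<upsilon>"
  proof (rule partition_onI)
    have "\<Union>\<upsilon> = {a..b} \<union> ({1..n} - {a..b})" by (auto simp only: \<upsilon>_def)
    also have "\<dots> = {1..n}" using assms(1-3) by auto
    finally show "\<Union>\<upsilon> = {1..n}" .
    show "disjnt p q" if "p \<in> \<upsilon>" "q \<in> \<upsilon>" "p \<noteq> q" for p q
    proof -
      have "p \<in> {{a..b}, {1..n} - {a..b}}" "q \<in> {{a..b}, {1..n} - {a..b}}"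
        using that(1,2) unfolding \<upsilon>_def by blast+
      then show ?thesis using \<open>p \<noteq> q\<close> by (auto simp del: atLeastAtMost_iff simp: disjnt_iff)
    qed
    show "{} \<notin> \<upsilon>" by (simp add: \<upsilon>_def)
  qed
  have "noncrossing \<upsilon>"
  proof (rule noncrossingI)
    fix V W x y z w
    assume "V \<in> \<upsilon>" "W \<in> \<upsilon>" "x < y" "y < z" "z < w" "x \<in> V" "z \<in> V" "y \<in> W" "w \<in> W"
    moreover from this have "V = {a..b} \<or> V = {1..n} - {a..b}" "W = {a..b} \<or> W = {1..n} - {a..b}"
      by (simp_all add: \<upsilon>_def)
    moreover have "y \<in> {a..b}" if "x \<in> {a..b}" "z \<in> {a..b}"
      using that \<open>x < y\<close> \<open>y < z\<close> by simp
    moreover have "z \<in> {a..b}" if "y \<in> {a..b}" "w \<in> {a..b}"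
      using that \<open>y < z\<close> \<open>z < w\<close> by simp
    ultimately show "V = W" by (metis DiffD2)
  qed
  then show "\<upsilon> \<in> NC_on {1..n}" using part by (simp add: NC_on_def)
  assume \<sigma>: "partition_on {1..n} \<sigma>" and sat: "saturated {a..b} \<sigma>"
  have "\<exists>Y\<in>\<upsilon>. X \<subseteq> Y" if X: "X \<in> \<sigma>" for X
  proof (cases "X \<subseteq> {a..b}")
    case True
    moreover have "{a..b} \<in> \<upsilon>" using assms(2) by (simp add: \<upsilon>_def)
    ultimately show ?thesis by (rule bexI)
  next
    case False
    then have "X \<inter> {a..b} = {}" using sat X by (auto simp: saturated_def)
    moreover have "X \<subseteq> {1..n}" "X \<noteq> {}" using \<sigma> X by (auto simp: partition_on_def)
    ultimately have "X \<subseteq> {1..n} - {a..b}" "{1..n} - {a..b} \<noteq> {}" by blast+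
    moreover from this have "{1..n} - {a..b} \<in> \<upsilon>" unfolding \<upsilon>_def by blast
    ultimately show ?thesis by blast
  qed
  then show "refines {1..n} \<sigma> \<upsilon>" using part \<sigma> by (simp add: refines_def)
qed

text \<open>Blocks are counted by their minima. The hull of a block is saturated for
  \<open>\<tau>\<close>, hence for every finer \<open>g i\<close>. Conversely, a common saturated
  interval {a..b} yields an upper bound that \<open>\<tau>\<close> refines, so the block of
  \<open>a\<close> stays inside {a..b} and has minimum \<open>a\<close>. Indexing by an arbitrary
  type lets the same count serve for a single partition.\<close>

lemma card_join:
  fixes g :: "'i \<Rightarrow> nat set set"
  assumes \<tau>: "\<tau> \<in> NC_on {1..n}"
    and ub: "\<And>i. refines {1..n} (g i) \<tau>"
    and least: "\<And>\<upsilon>. \<upsilon> \<in> NC_on {1..n} \<Longrightarrow> (\<And>i. refines {1..n} (g i) \<upsilon>) \<Longrightarrow> refines {1..n} \<tau> \<upsilon>"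
  shows "card \<tau> = card {a\<in>{1..n}. \<exists>b\<in>{a..n}. \<forall>i. saturated {a..b} (g i)}"
proof -
  have blk: "V \<subseteq> {1..n}" "V \<noteq> {}" "finite V" "Min V \<in> V" "Max V \<in> V" if "V \<in> \<tau>" for V
  proof -
    show "V \<subseteq> {1..n}" "V \<noteq> {}" using that NC_onD[OF \<tau>] by auto
    moreover from this show "finite V" using finite_subset by blast
    ultimately show "Min V \<in> V" "Max V \<in> V" by simp_all
  qed
  have "inj_on Min \<tau>"
    using NC_on_block_eq[OF \<tau>] blk(4) by (metis inj_onI)
  then have "card \<tau> = card (Min ` \<tau>)" by (simp add: card_image)
  also have "Min ` \<tau> = {a\<in>{1..n}. \<exists>b\<in>{a..n}. \<forall>i. saturated {a..b} (g i)}"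
  proof (intro equalityI subsetI)
    fix a assume "a \<in> Min ` \<tau>"
    then obtain V where V: "V \<in> \<tau>" "a = Min V" by auto
    have "saturated {a..Max V} (g i)" for i
      using saturated_refines[OF ub saturated_min_max_block[OF \<tau> V(1)]] V(2) by simp
    moreover have "a \<in> {1..n}" "Max V \<in> {a..n}"
    proof -
      have "Min V \<in> {1..n}" "Max V \<in> {1..n}" "Min V \<le> Max V"
        using blk[OF V(1)] by (blast, blast, simp)
      then show "a \<in> {1..n}" "Max V \<in> {a..n}" using V(2) by auto
    qed
    ultimately show "a \<in> {a\<in>{1..n}. \<exists>b\<in>{a..n}. \<forall>i. saturated {a..b} (g i)}" by blast
  next
    fix a assume "a \<in> {a\<in>{1..n}. \<exists>b\<in>{a..n}. \<forall>i. saturated {a..b} (g i)}"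
    then obtain b where ab: "1 \<le> a" "a \<le> b" "b \<le> n" and sat: "\<And>i. saturated {a..b} (g i)"
      by auto
    have "partition_on {1..n} (g i)" for i using ub[of i] by (simp add: refines_def)
    then have "refines {1..n} \<tau> ({{a..b}, {1..n} - {a..b}} - {{}})"
      using ab sat by (intro least interval_partition)
    moreover have "a \<in> \<Union>\<tau>" using NC_onD(3)[OF \<tau>] ab by simp
    then obtain V where V: "V \<in> \<tau>" "a \<in> V" by blast
    ultimately obtain Y where Y: "Y = {a..b} \<or> Y = {1..n} - {a..b}" "V \<subseteq> Y"
      unfolding refines_def by (metis Diff_iff insert_iff empty_iff)
    have "a \<notin> {1..n} - {a..b}" using ab by simp
    then have "V \<subseteq> {a..b}" using Y V(2) by blast
    then have "Min V = a" using V blk(3)[OF V(1)] by (intro Min_eqI) auto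
    then show "a \<in> Min ` \<tau>" using V by auto
  qed
  finally show ?thesis .
qed

section \<open>Relabelling the ground set and cutting along a saturated set\<close>

lemma NC_on_image:
  assumes "\<sigma> \<in> NC_on A" "strict_mono_on A f"
  shows "image (image f) \<sigma> \<in> NC_on (f ` A)"
proof -
  have inj: "inj_on f A" using assms(2) by (rule strict_mono_on_imp_inj_on)
  have lt: "x < y" if "f x < f y" "x \<in> A" "y \<in> A" for x y
    using strict_mono_on_less[OF assms(2)] that by blast
  have "(`) f ` \<sigma> - {{}} = (`) f ` \<sigma>" using NC_onD(4)[OF assms(1)] by auto
  then have "partition_on (f ` A) ((`) f ` \<sigma>)"
    using partition_on_inj_image[OF NC_onD(1)[OF assms(1)] inj] by simp
  moreover have "noncrossing ((`) f ` \<sigma>)"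
  proof (rule noncrossingI)
    fix V W a b c d
    assume V: "V \<in> (`) f ` \<sigma>" and W: "W \<in> (`) f ` \<sigma>"
      and l: "a < b" "b < c" "c < d" and m: "a \<in> V" "c \<in> V" "b \<in> W" "d \<in> W"
    obtain V' W' where V': "V' \<in> \<sigma>" "V = f ` V'" and W': "W' \<in> \<sigma>" "W = f ` W'"
      using V W by auto
    obtain a' b' c' d' where p: "a' \<in> V'" "c' \<in> V'" "b' \<in> W'" "d' \<in> W'"
        "a = f a'" "b = f b'" "c = f c'" "d = f d'"
      using m V' W' by auto
    have "a' \<in> A" "b' \<in> A" "c' \<in> A" "d' \<in> A" using p V' W' NC_onD(3)[OF assms(1)] by auto
    then have "a' < b'" "b' < c'" "c' < d'"
      using lt[of a' b'] lt[of b' c'] lt[of c' d'] l p by simp_all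
    then show "V = W" using noncrossingD[OF NC_onD(2)[OF assms(1)] V'(1) W'(1)] p V' W' by blast
  qed
  ultimately show ?thesis by (simp add: NC_on_def)
qed

lemma bij_betw_NC_on_image:
  assumes "strict_mono_on A f"
  shows "bij_betw (image (image f)) (NC_on A) (NC_on (f ` A))"
proof -
  have inj: "inj_on f A" using assms by (rule strict_mono_on_imp_inj_on)
  define h where "h = inv_into A f"
  have hf: "h (f x) = x" if "x \<in> A" for x using inj that by (simp add: h_def)
  have h: "strict_mono_on (f ` A) h"
    using assms hf by (auto simp: strict_mono_on_def strict_mono_on_less[OF assms])
  have hfA: "h ` f ` A = A" using hf by force
  show ?thesis
  proof (rule bij_betw_byWitness[where f' = "image (image h)"])
    show "\<forall>\<sigma>\<in>NC_on A. (`) ((`) h) ((`) ((`) f) \<sigma>) = \<sigma>"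
    proof
      fix \<sigma> assume \<sigma>: "\<sigma> \<in> NC_on A"
      have "h ` f ` B = B" if "B \<in> \<sigma>" for B
      proof -
        have "h (f x) = x" if "x \<in> B" for x
          using \<open>B \<in> \<sigma>\<close> that NC_onD(3)[OF \<sigma>] hf by auto
        then show ?thesis by (simp add: image_image)
      qed
      then show "(`) ((`) h) ((`) ((`) f) \<sigma>) = \<sigma>" by (simp add: image_image)
    qed
    show "\<forall>\<sigma>\<in>NC_on (f ` A). (`) ((`) f) ((`) ((`) h) \<sigma>) = \<sigma>"
    proof
      fix \<sigma> assume \<sigma>: "\<sigma> \<in> NC_on (f ` A)"
      have "f ` h ` B = B" if "B \<in> \<sigma>" for B
      proof -
        have "f (h y) = y" if "y \<in> B" for y
        proof -
          have "y \<in> f ` A" using \<open>B \<in> \<sigma>\<close> that NC_onD(3)[OF \<sigma>] by blast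
          then show ?thesis using hf by auto
        qed
        then show ?thesis by (simp add: image_image)
      qed
      then show "(`) ((`) f) ((`) ((`) h) \<sigma>) = \<sigma>" by (simp add: image_image)
    qed
    show "(`) ((`) f) ` NC_on A \<subseteq> NC_on (f ` A)" using NC_on_image[OF _ assms] by auto
    show "(`) ((`) h) ` NC_on (f ` A) \<subseteq> NC_on A" using NC_on_image[OF _ h] hfA by auto
  qed
qed

lemma saturated_image:
  assumes "inj_on f A" "\<Union>\<sigma> \<subseteq> A" "I \<subseteq> A"
  shows "saturated (f ` I) (image (image f) \<sigma>) \<longleftrightarrow> saturated I \<sigma>"
proof -
  have "f ` B \<subseteq> f ` I \<longleftrightarrow> B \<subseteq> I" "f ` B \<inter> f ` I = {} \<longleftrightarrow> B \<inter> I = {}" if "B \<in> \<sigma>" for B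
  proof -
    have B: "B \<subseteq> A" using that assms(2) by auto
    show "f ` B \<subseteq> f ` I \<longleftrightarrow> B \<subseteq> I"
      using inj_on_image_subset_iff[OF assms(1) B assms(3)] .
    show "f ` B \<inter> f ` I = {} \<longleftrightarrow> B \<inter> I = {}"
      using inj_on_image_Int[OF assms(1) B assms(3)] by auto
  qed
  then show ?thesis by (simp add: saturated_def)
qed

text \<open>Gluing is the delicate direction. In a crossing x < y < z < w between a block in I and
  one in A - I, two points of I enclose a point of A - I: x and z enclose y, or y and w enclose z.
  Convexity of I relative to A forbids this.\<close>

lemma NC_on_split:
  assumes IA: "I \<subseteq> A"
    and convex: "\<And>x y z. x \<in> I \<Longrightarrow> y \<in> I \<Longrightarrow> z \<in> A \<Longrightarrow> x < z \<Longrightarrow> z < y \<Longrightarrow> z \<in> I"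
  shows "bij_betw (\<lambda>\<sigma>. (\<sigma> \<inter> Pow I, \<sigma> \<inter> Pow (A - I))) {\<sigma>\<in>NC_on A. saturated I \<sigma>}
           (NC_on I \<times> NC_on (A - I))"
proof (rule bij_betw_byWitness[where f' = "\<lambda>(\<alpha>, \<beta>). \<alpha> \<union> \<beta>"])
  have cover: "\<sigma> = \<sigma> \<inter> Pow I \<union> \<sigma> \<inter> Pow (A - I)"
    if "\<sigma> \<in> NC_on A" "saturated I \<sigma>" for \<sigma>
    using NC_onD(3)[OF that(1)] that(2) unfolding saturated_def by blast
  then show "\<forall>\<sigma>\<in>{\<sigma>\<in>NC_on A. saturated I \<sigma>}.
      (case (\<sigma> \<inter> Pow I, \<sigma> \<inter> Pow (A - I)) of (\<alpha>, \<beta>) \<Rightarrow> \<alpha> \<union> \<beta>) = \<sigma>"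
    by auto
  show "\<forall>p\<in>NC_on I \<times> NC_on (A - I).
      ((case p of (\<alpha>, \<beta>) \<Rightarrow> \<alpha> \<union> \<beta>) \<inter> Pow I, (case p of (\<alpha>, \<beta>) \<Rightarrow> \<alpha> \<union> \<beta>) \<inter> Pow (A - I)) = p"
  proof (clarify, intro conjI)
    fix \<alpha> \<beta> assume \<alpha>: "\<alpha> \<in> NC_on I" and \<beta>: "\<beta> \<in> NC_on (A - I)"
    have "B \<noteq> {}" "B \<subseteq> I" if "B \<in> \<alpha>" for B using NC_onD[OF \<alpha>] that by auto
    moreover have "B \<noteq> {}" "B \<subseteq> A - I" if "B \<in> \<beta>" for B using NC_onD[OF \<beta>] that by auto
    ultimately have "\<alpha> \<subseteq> Pow I" "\<beta> \<subseteq> Pow (A - I)" "\<alpha> \<inter> Pow (A - I) = {}" "\<beta> \<inter> Pow I = {}" by fast+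
    then show "(\<alpha> \<union> \<beta>) \<inter> Pow I = \<alpha>" "(\<alpha> \<union> \<beta>) \<inter> Pow (A - I) = \<beta>"
      by (simp_all add: Int_Un_distrib2 Int_absorb2)
  qed
  show "(\<lambda>\<sigma>. (\<sigma> \<inter> Pow I, \<sigma> \<inter> Pow (A - I))) ` {\<sigma>\<in>NC_on A. saturated I \<sigma>} \<subseteq> NC_on I \<times> NC_on (A - I)"
  proof clarify
    fix \<sigma> assume \<sigma>: "\<sigma> \<in> NC_on A" and sat: "saturated I \<sigma>"
    have part: "partition_on J (\<sigma> \<inter> Pow J)" if "\<And>x. x \<in> J \<Longrightarrow> \<exists>B\<in>\<sigma>. x \<in> B \<and> B \<subseteq> J" for J
    proof (rule partition_onI)
      show "\<Union> (\<sigma> \<inter> Pow J) = J" using that by auto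
      show "disjnt p q" if "p \<in> \<sigma> \<inter> Pow J" "q \<in> \<sigma> \<inter> Pow J" "p \<noteq> q" for p q
        using NC_on_block_eq[OF \<sigma>, of p q] that by (auto simp: disjnt_iff)
      show "{} \<notin> \<sigma> \<inter> Pow J" using NC_onD(4)[OF \<sigma>] by auto
    qed
    have "noncrossing (\<sigma> \<inter> Pow J)" for J
      by (intro noncrossingI, elim IntE) (rule noncrossingD[OF NC_onD(2)[OF \<sigma>]]; assumption)
    moreover have "\<exists>B\<in>\<sigma>. x \<in> B \<and> B \<subseteq> I" if "x \<in> I" for x
    proof -
      have "x \<in> \<Union>\<sigma>" using that NC_onD(3)[OF \<sigma>] IA by blast
      then obtain B where "B \<in> \<sigma>" "x \<in> B" by blast
      moreover from this have "B \<subseteq> I" using sat that unfolding saturated_def by blast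
      ultimately show ?thesis by blast
    qed
    moreover have "\<exists>B\<in>\<sigma>. x \<in> B \<and> B \<subseteq> A - I" if "x \<in> A - I" for x
      using that sat NC_onD(3)[OF \<sigma>] unfolding saturated_def by blast
    ultimately show "\<sigma> \<inter> Pow I \<in> NC_on I \<and> \<sigma> \<inter> Pow (A - I) \<in> NC_on (A - I)"
      using part[of I] part[of "A - I"] by (simp add: NC_on_def)
  qed
  show "(\<lambda>(\<alpha>, \<beta>). \<alpha> \<union> \<beta>) ` (NC_on I \<times> NC_on (A - I)) \<subseteq> {\<sigma> \<in> NC_on A. saturated I \<sigma>}"
  proof clarify
    fix \<alpha> \<beta> assume \<alpha>: "\<alpha> \<in> NC_on I" and \<beta>: "\<beta> \<in> NC_on (A - I)"
    have a: "B \<subseteq> I" if "B \<in> \<alpha>" for B using NC_onD[OF \<alpha>] that by auto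
    have b: "B \<subseteq> A - I" if "B \<in> \<beta>" for B using NC_onD[OF \<beta>] that by auto
    have "partition_on A (\<alpha> \<union> \<beta>)"
    proof (rule partition_onI)
      show "\<Union> (\<alpha> \<union> \<beta>) = A" using NC_onD(3)[OF \<alpha>] NC_onD(3)[OF \<beta>] IA by auto
      show "{} \<notin> \<alpha> \<union> \<beta>" using NC_onD(4)[OF \<alpha>] NC_onD(4)[OF \<beta>] by auto
      show "disjnt p q" if "p \<in> \<alpha> \<union> \<beta>" "q \<in> \<alpha> \<union> \<beta>" "p \<noteq> q" for p q
        using that NC_on_block_eq[OF \<alpha>, of p q] NC_on_block_eq[OF \<beta>, of p q] a b
        unfolding disjnt_iff by blast
    qed
    moreover have "noncrossing (\<alpha> \<union> \<beta>)"
    proof (rule noncrossingI)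
      fix V W x y z w
      assume V: "V \<in> \<alpha> \<union> \<beta>" and W: "W \<in> \<alpha> \<union> \<beta>" and l: "x < y" "y < z" "z < w"
        and m: "x \<in> V" "z \<in> V" "y \<in> W" "w \<in> W"
      consider "V \<in> \<alpha>" "W \<in> \<alpha>" | "V \<in> \<beta>" "W \<in> \<beta>" | "V \<in> \<alpha>" "W \<in> \<beta>" | "V \<in> \<beta>" "W \<in> \<alpha>"
        using V W by auto
      then show "V = W"
      proof cases
        case 1 then show ?thesis using noncrossingD[OF NC_onD(2)[OF \<alpha>]] l m by blast
      next
        case 2 then show ?thesis using noncrossingD[OF NC_onD(2)[OF \<beta>]] l m by blast
      next
        case 3 then show ?thesis using convex[of x z y] a b l m by blast
      next
        case 4 then show ?thesis using convex[of y w z] a b l m by blast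
      qed
    qed
    moreover have "saturated I (\<alpha> \<union> \<beta>)" using a b unfolding saturated_def by blast
    ultimately show "\<alpha> \<union> \<beta> \<in> NC_on A \<and> saturated I (\<alpha> \<union> \<beta>)" by (simp add: NC_on_def)
  qed
qed

lemma saturated_restrict:
  assumes "saturated I \<sigma>" "J \<subseteq> I"
  shows "saturated J (\<sigma> \<inter> Pow I) \<longleftrightarrow> saturated J \<sigma>"
  using assms unfolding saturated_def by blast

section \<open>Counting by the shortest saturated interval\<close>

lemma bij_betw_families:
  assumes "bij_betw f X Y"
  shows "bij_betw (\<lambda>g i. f (g i)) {g. \<forall>i. g i \<in> X} {g. \<forall>i. g i \<in> Y}"
proof (rule bij_betw_byWitness[where f' = "\<lambda>g i. inv_into X f (g i)"])
  show "\<forall>g\<in>{g. \<forall>i. g i \<in> X}. (\<lambda>i. inv_into X f (f (g i))) = g"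
    using assms by (auto simp: bij_betw_def)
  show "\<forall>g\<in>{g. \<forall>i. g i \<in> Y}. (\<lambda>i. f (inv_into X f (g i))) = g"
    using assms by (auto simp: bij_betw_inv_into_right)
  show "(\<lambda>g i. f (g i)) ` {g. \<forall>i. g i \<in> X} \<subseteq> {g. \<forall>i. g i \<in> Y}"
    using bij_betwE[OF assms] by auto
  show "(\<lambda>g i. inv_into X f (g i)) ` {g. \<forall>i. g i \<in> Y} \<subseteq> {g. \<forall>i. g i \<in> X}"
    using bij_betwE[OF bij_betw_inv_into[OF assms]] by auto
qed

text \<open>Families indexed by a finite type: with \<^typ>\<open>bool\<close> they are the pairs of the theorem, with
  \<^typ>\<open>unit\<close> the single partitions needed for the Catalan numbers.\<close>
definition NC_fam :: "nat set \<Rightarrow> ('i::finite \<Rightarrow> nat set set) set" where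
  "NC_fam A = {g. \<forall>i. g i \<in> NC_on A}"

abbreviation sat_fam :: "nat set \<Rightarrow> ('i::finite \<Rightarrow> nat set set) \<Rightarrow> bool" where
  "sat_fam I g \<equiv> (\<forall>i. saturated I (g i))"

text \<open>For pairs and a = 1 these are the objects counted by U. The cut j = b is left out
  because the whole interval is always saturated. The general left end \<open>a\<close> is there
  because an interval cut out of {1..n} keeps its labels.\<close>

definition irreducible_fam :: "nat \<Rightarrow> nat \<Rightarrow> ('i::finite \<Rightarrow> nat set set) set" where
  "irreducible_fam a b = {g\<in>NC_fam {a..b}. \<forall>j\<in>{a..<b}. \<not> sat_fam {a..j} g}"

lemma NC_fam_eq_PiE: "(NC_fam A :: ('i::finite \<Rightarrow> _) set) = (UNIV \<rightarrow>\<^sub>E NC_on A)"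
  by (auto simp: NC_fam_def PiE_def)

lemma finite_NC_fam: "finite A \<Longrightarrow> finite (NC_fam A)"
  by (simp add: NC_fam_eq_PiE finite_NC_on finite_PiE)

lemma card_NC_fam: "card (NC_fam A :: ('i::finite \<Rightarrow> _) set) = card (NC_on A) ^ CARD('i)"
  by (simp add: NC_fam_eq_PiE card_funcsetE)

lemma bij_betw_NC_fam_split:
  assumes IA: "I \<subseteq> A"
    and convex: "\<And>x y z. x \<in> I \<Longrightarrow> y \<in> I \<Longrightarrow> z \<in> A \<Longrightarrow> x < z \<Longrightarrow> z < y \<Longrightarrow> z \<in> I"
  shows "bij_betw (\<lambda>g. (\<lambda>i. g i \<inter> Pow I, \<lambda>i. g i \<inter> Pow (A - I))) {g\<in>NC_fam A. sat_fam I g}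
           (NC_fam I \<times> NC_fam (A - I))"
proof -
  let ?f = "\<lambda>\<sigma>. (\<sigma> \<inter> Pow I, \<sigma> \<inter> Pow (A - I))"
  have "bij_betw (\<lambda>p. (\<lambda>i. fst (p i), \<lambda>i. snd (p i))) {p. \<forall>i. p i \<in> NC_on I \<times> NC_on (A - I)}
      (NC_fam I \<times> NC_fam (A - I))"
    by (rule bij_betw_byWitness[where f' = "\<lambda>(g, h) i. (g i, h i)"])
      (auto simp: NC_fam_def mem_Times_iff)
  from bij_betw_trans[OF bij_betw_families[OF NC_on_split[OF IA convex]] this]
  show ?thesis by (simp add: comp_def NC_fam_def all_conj_distrib)
qed

text \<open>Being non-crossing depends only on the order of the points, so the gap may be closed by
  a strictly increasing relabelling.\<close>

lemma card_NC_on_Diff_interval: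
  assumes "1 \<le> a" "a \<le> Suc b" "b \<le> n"
  shows "card (NC_on ({1..n} - {a..b})) = card (NC (n - (Suc b - a)))"
proof -
  define f where "f x = (if x < a then x else x + (Suc b - a))" for x :: nat
  have "strict_mono_on {1..n - (Suc b - a)} f"
    by (auto simp: strict_mono_on_def f_def)
  moreover have "f ` {1..n - (Suc b - a)} = {1..n} - {a..b}"
  proof (intro equalityI subsetI)
    fix x assume x: "x \<in> {1..n} - {a..b}"
    show "x \<in> f ` {1..n - (Suc b - a)}"
    proof (cases "x < a")
      case True
      then show ?thesis using x assms by (intro image_eqI[of _ _ x]) (auto simp: f_def)
    next
      case False
      then show ?thesis using x assms by (intro image_eqI[of _ _ "x - (Suc b - a)"]) (auto simp: f_def)
    qed
  qed (use assms in \<open>auto simp: f_def split: if_splits\<close>)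
  ultimately show ?thesis
    using bij_betw_same_card[OF bij_betw_NC_on_image] by (metis NC_eq_NC_on)
qed

lemma card_irreducible_fam_shift:
  assumes "1 \<le> a" "a \<le> b"
  shows "card (irreducible_fam a b :: ('i::finite \<Rightarrow> _) set) =
    card (irreducible_fam 1 (Suc b - a) :: ('i \<Rightarrow> _) set)"
proof -
  define f where "f x = x + (a - 1)" for x :: nat
  let ?k = "Suc b - a"
  have f: "strict_mono_on {1..?k} f" by (auto simp: strict_mono_on_def f_def)
  have im: "f ` {1..j} = {a..f j}" for j
    using assms image_add_atLeastAtMost'[of "a - 1" 1 j] by (simp add: f_def)
  have fk: "f ?k = b" using assms by (simp add: f_def)
  have bij: "bij_betw (\<lambda>g i. image (image f) (g i)) (NC_fam {1..?k} :: ('i \<Rightarrow> _) set) (NC_fam {a..b})"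
    using bij_betw_families[OF bij_betw_NC_on_image[OF f]] im[of ?k] by (simp add: NC_fam_def fk)
  have "bij_betw (\<lambda>g i. image (image f) (g i)) (irreducible_fam 1 ?k :: ('i \<Rightarrow> _) set) (irreducible_fam a b)"
    unfolding irreducible_fam_def
  proof (rule bij_betw_Collect[OF bij])
    fix g :: "'i \<Rightarrow> nat set set" assume g: "g \<in> NC_fam {1..?k}"
    have "saturated {a..f j} (image (image f) (g i)) \<longleftrightarrow> saturated {1..j} (g i)" if "j \<in> {1..<?k}" for i j
      using saturated_image[OF strict_mono_on_imp_inj_on[OF f], of "g i" "{1..j}"] g that im[of j]
        NC_onD(3)[of "g i" "{1..?k}"] by (auto simp: NC_fam_def)
    moreover have "{a..<b} = f ` {1..<?k}"
      using assms image_add_atLeastLessThan'[of "a - 1" 1 ?k] by (simp add: f_def)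
    ultimately show "(\<forall>j\<in>{a..<b}. \<not> sat_fam {a..j} (\<lambda>i. image (image f) (g i))) \<longleftrightarrow>
        (\<forall>j\<in>{1..<?k}. \<not> sat_fam {1..j} g)"
      by simp
  qed
  from bij_betw_same_card[OF this] show ?thesis by simp
qed

text \<open>That {a..b} is the shortest saturated interval starting at \<open>a\<close> is a
  condition on the part inside {a..b} alone; the part outside is free. The count therefore depends
  on the interval only through its length.\<close>

lemma card_first_saturated:
  assumes "1 \<le> a" "a \<le> b" "b \<le> n"
  shows "card {g\<in>NC_fam {1..n} :: ('i::finite \<Rightarrow> _) set. sat_fam {a..b} g \<and> (\<forall>j\<in>{a..<b}. \<not> sat_fam {a..j} g)} =
    card (irreducible_fam 1 (Suc b - a) :: ('i \<Rightarrow> _) set) * card (NC (n - (Suc b - a))) ^ CARD('i)"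
proof -
  let ?A = "{1..n}" and ?I = "{a..b}"
  let ?X = "{g\<in>NC_fam ?A :: ('i \<Rightarrow> _) set. sat_fam ?I g}"
  let ?f = "\<lambda>g :: 'i \<Rightarrow> _. (\<lambda>i. g i \<inter> Pow ?I, \<lambda>i. g i \<inter> Pow (?A - ?I))"
  have bij: "bij_betw ?f ?X (NC_fam ?I \<times> NC_fam (?A - ?I))"
    using assms by (intro bij_betw_NC_fam_split) auto
  have bij': "bij_betw ?f {g\<in>?X. \<forall>j\<in>{a..<b}. \<not> sat_fam {a..j} g}
     {p\<in>NC_fam ?I \<times> NC_fam (?A - ?I). \<forall>j\<in>{a..<b}. \<not> sat_fam {a..j} (fst p)}"
  proof (rule bij_betw_Collect[OF bij])
    fix g assume g: "g \<in> ?X"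
    have "saturated {a..j} (g i \<inter> Pow ?I) \<longleftrightarrow> saturated {a..j} (g i)" if "j \<in> {a..<b}" for i j
      using that g by (intro saturated_restrict) auto
    then show "(\<forall>j\<in>{a..<b}. \<not> sat_fam {a..j} (fst (?f g))) = (\<forall>j\<in>{a..<b}. \<not> sat_fam {a..j} g)"
      by simp
  qed
  have cod: "{p\<in>NC_fam ?I \<times> NC_fam (?A - ?I). \<forall>j\<in>{a..<b}. \<not> sat_fam {a..j} (fst p)} =
     (irreducible_fam a b :: ('i \<Rightarrow> _) set) \<times> (NC_fam (?A - ?I) :: ('i \<Rightarrow> _) set)"
    by (auto simp: irreducible_fam_def)
  have dom: "{g\<in>?X. \<forall>j\<in>{a..<b}. \<not> sat_fam {a..j} g} =
    {g\<in>NC_fam {1..n} :: ('i::finite \<Rightarrow> _) set. sat_fam {a..b} g \<and> (\<forall>j\<in>{a..<b}. \<not> sat_fam {a..j} g)}"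
    by auto
  show ?thesis
    using assms(1,2) unfolding bij_betw_same_card[OF bij', unfolded cod dom] card_cartesian_product card_NC_fam
      card_irreducible_fam_shift[OF assms(1,2)] 
    by (subst card_NC_on_Diff_interval[OF assms(1) _ assms(3)]) auto
qed

text \<open>Sorts the families by the least admissible \<open>b\<close>; k = b - a + 1 is the length
  of the shortest saturated interval.\<close>

lemma card_saturated_from:
  assumes "1 \<le> a" "a \<le> n"
  shows "card {g\<in>NC_fam {1..n} :: ('i::finite \<Rightarrow> _) set. \<exists>b\<in>{a..n}. sat_fam {a..b} g} =
    (\<Sum>k=1..Suc n - a. card (irreducible_fam 1 k :: ('i \<Rightarrow> _) set) * card (NC (n - k)) ^ CARD('i))"
proof -
  define X where "X b = {g\<in>NC_fam {1..n} :: ('i \<Rightarrow> _) set. sat_fam {a..b} g \<and> (\<forall>j\<in>{a..<b}. \<not> sat_fam {a..j} g)}" for b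
  have "{g\<in>NC_fam {1..n} :: ('i::finite \<Rightarrow> _) set. \<exists>b\<in>{a..n}. sat_fam {a..b} g} = (\<Union>b\<in>{a..n}. X b)"
  proof (intro equalityI subsetI)
    fix g :: "'i \<Rightarrow> _" assume g: "g \<in> {g\<in>NC_fam {1..n}. \<exists>b\<in>{a..n}. sat_fam {a..b} g}"
    define b where "b = (LEAST b. b \<in> {a..n} \<and> sat_fam {a..b} g)"
    have "b \<in> {a..n} \<and> sat_fam {a..b} g"
      unfolding b_def by (rule LeastI_ex) (use g in auto)
    moreover have "\<not> sat_fam {a..j} g" if "j \<in> {a..<b}" for j
      using not_less_Least[of j "\<lambda>b. b \<in> {a..n} \<and> sat_fam {a..b} g"] that calculation
      unfolding b_def[symmetric] by auto
    ultimately have "b \<in> {a..n}" "g \<in> X b" using g by (simp_all add: X_def)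
    then show "g \<in> (\<Union>b\<in>{a..n}. X b)" by (rule UN_I)
  qed (auto simp: X_def)
  also have "card \<dots> = (\<Sum>b=a..n. card (X b))"
  proof (rule card_UN_disjoint)
    show "\<forall>b\<in>{a..n}. finite (X b)" by (auto simp: X_def finite_NC_fam)
    have "X b \<inter> X b' = {}" if "b < b'" "a \<le> b" for b b'
    proof -
      have "b \<in> {a..<b'}" using that by simp
      then show ?thesis unfolding X_def by blast
    qed
    then show "\<forall>b\<in>{a..n}. \<forall>b'\<in>{a..n}. b \<noteq> b' \<longrightarrow> X b \<inter> X b' = {}"
      by (metis Int_commute atLeastAtMost_iff nat_neq_iff)
  qed simp
  also have "\<dots> = (\<Sum>b=a..n. card (irreducible_fam 1 (Suc b - a) :: ('i \<Rightarrow> _) set) * card (NC (n - (Suc b - a))) ^ CARD('i))"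
    using assms unfolding X_def by (intro sum.cong refl card_first_saturated) auto
  also have "\<dots> = (\<Sum>k=1..Suc n - a. card (irreducible_fam 1 k :: ('i \<Rightarrow> _) set) * card (NC (n - k)) ^ CARD('i))"
    using assms by (intro sum.reindex_bij_witness[where i = "\<lambda>k. k + a - 1" and j = "\<lambda>b. Suc b - a"]) auto
  finally show ?thesis .
qed

text \<open>The case a = 1 of the previous count. Since {1..n} is always saturated, every family
  occurs. This is the coefficient form of M = 1 + U M for any number of partitions.\<close>

lemma NC_fam_first_return:
  assumes "n \<ge> 1"
  shows "card (NC n) ^ CARD('i::finite) =
    (\<Sum>k=1..n. card (irreducible_fam 1 k :: ('i \<Rightarrow> _) set) * card (NC (n - k)) ^ CARD('i))"
proof -
  have "sat_fam {1..n} g" if "g \<in> NC_fam {1..n}" for g :: "'i \<Rightarrow> _"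
  proof
    fix i
    have "\<Union>(g i) = {1..n}" using that NC_onD(3) by (simp add: NC_fam_def)
    then show "saturated {1..n} (g i)" unfolding saturated_def by blast
  qed
  moreover have "n \<in> {1..n}" using assms by simp
  ultimately have "{g\<in>NC_fam {1..n} :: ('i \<Rightarrow> _) set. \<exists>b\<in>{1..n}. sat_fam {1..b} g} = NC_fam {1..n}"
    by blast
  then show ?thesis
    using card_saturated_from[OF order_refl assms, where ?'i = 'i] by (simp add: card_NC_fam NC_eq_NC_on)
qed

text \<open>Double counting of families and starting points. The weight \<open>Suc n - k\<close> is
  the number of positions of an interval of length k in {1..n}; it is what produces the derivative
  of z M.\<close>

lemma sum_saturated_starts:
  "(\<Sum>g\<in>(NC_fam {1..n} :: ('i::finite \<Rightarrow> _) set). card {a\<in>{1..n}. \<exists>b\<in>{a..n}. sat_fam {a..b} g}) =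
    (\<Sum>k=1..n. (Suc n - k) * (card (irreducible_fam 1 k :: ('i \<Rightarrow> _) set) * card (NC (n - k)) ^ CARD('i)))"
proof -
  define f where "f k = card (irreducible_fam 1 k :: ('i \<Rightarrow> _) set) * card (NC (n - k)) ^ CARD('i)" for k
  have "(\<Sum>g\<in>(NC_fam {1..n} :: ('i::finite \<Rightarrow> _) set). card {a\<in>{1..n}. \<exists>b\<in>{a..n}. sat_fam {a..b} g}) =
     (\<Sum>a=1..n. card {g\<in>NC_fam {1..n} :: ('i \<Rightarrow> _) set. \<exists>b\<in>{a..n}. sat_fam {a..b} g})"
    by (rule sum_multicount_gen) (auto simp: finite_NC_fam)
  also have "\<dots> = (\<Sum>a=1..n. \<Sum>k=1..Suc n - a. f k)"
    unfolding f_def by (intro sum.cong refl card_saturated_from) auto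
  also have "\<dots> = (\<Sum>a=1..n. \<Sum>k\<in>{k\<in>{1..n}. a + k \<le> Suc n}. f k)"
    by (intro sum.cong refl) auto
  also have "\<dots> = (\<Sum>k=1..n. \<Sum>a\<in>{a\<in>{1..n}. a + k \<le> Suc n}. f k)"
    by (rule sum.swap_restrict) auto
  also have "\<dots> = (\<Sum>k=1..n. (Suc n - k) * f k)"
  proof (rule sum.cong[OF refl])
    fix k assume "k \<in> {1..n}"
    then have "{a\<in>{1..n}. a + k \<le> Suc n} = {1..Suc n - k}" by auto
    then show "(\<Sum>a\<in>{a\<in>{1..n}. a + k \<le> Suc n}. f k) = (Suc n - k) * f k" by simp
  qed
  finally show ?thesis by (simp only: f_def)
qed

section \<open>Single partitions and the Catalan recurrence\<close>

text \<open>The hull of the block of 1 is itself a saturated initial segment, so irreducibility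
  forces that block to reach \<open>k\<close>. A block containing both 1 and \<open>k\<close> in
  turn meets every proper initial segment without lying in it.\<close>

lemma irreducible_iff_same_block:
  assumes \<sigma>: "\<sigma> \<in> NC_on {1..k}" and k: "1 \<le> k"
  shows "(\<forall>j\<in>{1..<k}. \<not> saturated {1..j} \<sigma>) \<longleftrightarrow> (\<exists>B\<in>\<sigma>. 1 \<in> B \<and> k \<in> B)"
proof
  have "1 \<in> \<Union>\<sigma>" using NC_onD(3)[OF \<sigma>] k by simp
  then obtain B where B: "B \<in> \<sigma>" "1 \<in> B" by blast
  have sub: "B \<subseteq> {1..k}" using NC_onD(3)[OF \<sigma>] B by blast
  then have fin: "finite B" using finite_subset by blast
  have "Min B = 1" using B sub fin by (intro Min_eqI) auto
  then have sat: "saturated {1..Max B} \<sigma>" using saturated_min_max_block[OF \<sigma> B(1)] by simp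
  have mx: "Max B \<in> B" using fin B by (intro Max_in) auto
  assume "\<forall>j\<in>{1..<k}. \<not> saturated {1..j} \<sigma>"
  then have "Max B \<notin> {1..<k}" using sat by blast
  then have "Max B = k" using mx sub by fastforce
  then show "\<exists>B\<in>\<sigma>. 1 \<in> B \<and> k \<in> B" using B mx by auto
next
  assume "\<exists>B\<in>\<sigma>. 1 \<in> B \<and> k \<in> B"
  then obtain B where B: "B \<in> \<sigma>" "1 \<in> B" "k \<in> B" by auto
  show "\<forall>j\<in>{1..<k}. \<not> saturated {1..j} \<sigma>"
  proof
    fix j assume "j \<in> {1..<k}"
    then have "1 \<in> {1..j}" "k \<notin> {1..j}" by auto
    then show "\<not> saturated {1..j} \<sigma>" using B unfolding saturated_def by blast
  qed
qed

text \<open>The block of \<open>Suc k\<close> also contains 1, which differs from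
  \<open>Suc k\<close> as k >= 1, so no block becomes empty.\<close>

lemma NC_on_remove_max:
  assumes \<sigma>: "\<sigma> \<in> NC_on {1..Suc k}" and B: "B \<in> \<sigma>" "1 \<in> B" "Suc k \<in> B" and k: "1 \<le> k"
  shows "(\<lambda>B. B - {Suc k}) ` \<sigma> \<in> NC_on {1..k}"
proof -
  have ne: "V - {Suc k} \<noteq> {}" if "V \<in> \<sigma>" for V
  proof (cases "Suc k \<in> V")
    case True
    then have "V = B" using NC_on_block_eq[OF \<sigma> that B(1)] B by blast
    moreover have "1 \<in> B - {Suc k}" using B k by simp
    ultimately show ?thesis by blast
  next
    case False
    then show ?thesis using NC_onD(4)[OF \<sigma>] that by auto
  qed
  have "partition_on {1..k} ((\<lambda>B. B - {Suc k}) ` \<sigma>)"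
  proof (rule partition_onI)
    have "\<Union> ((\<lambda>B. B - {Suc k}) ` \<sigma>) = \<Union>\<sigma> - {Suc k}" by blast
    also have "\<dots> = {1..k}" using NC_onD(3)[OF \<sigma>] by auto
    finally show "\<Union> ((\<lambda>B. B - {Suc k}) ` \<sigma>) = {1..k}" .
    show "{} \<notin> (\<lambda>B. B - {Suc k}) ` \<sigma>" using ne by blast
    fix p q assume "p \<in> (\<lambda>B. B - {Suc k}) ` \<sigma>" "q \<in> (\<lambda>B. B - {Suc k}) ` \<sigma>" "p \<noteq> q"
    then obtain V W where VW: "V \<in> \<sigma>" "W \<in> \<sigma>" "V \<noteq> W" "p = V - {Suc k}" "q = W - {Suc k}" by blast
    show "disjnt p q"
      using NC_on_block_eq[OF \<sigma> VW(1,2)] VW(3-5) unfolding disjnt_iff by blast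
  qed
  moreover have "noncrossing ((\<lambda>B. B - {Suc k}) ` \<sigma>)"
  proof (rule noncrossingI)
    fix V W a b c d
    assume "V \<in> (\<lambda>B. B - {Suc k}) ` \<sigma>" "W \<in> (\<lambda>B. B - {Suc k}) ` \<sigma>"
      and l: "a < b" "b < c" "c < d" "a \<in> V" "c \<in> V" "b \<in> W" "d \<in> W"
    then obtain V' W' where VW: "V' \<in> \<sigma>" "W' \<in> \<sigma>" "V = V' - {Suc k}" "W = W' - {Suc k}" by blast
    then have "V' = W'" using noncrossingD[OF NC_onD(2)[OF \<sigma>] VW(1,2) l(1-3)] l by blast
    then show "V = W" using VW by simp
  qed
  ultimately show ?thesis by (simp add: NC_on_def)
qed

text \<open>A new crossing a < b < c < d would have d = \<open>Suc k\<close>, so b lies in the block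
  of 1. If a = 1, both blocks are that block; otherwise 1 < a < b < c is already a crossing in
  \<open>\<sigma>\<close>.\<close>

lemma NC_on_insert_max:
  assumes \<sigma>: "\<sigma> \<in> NC_on {1..k}" and k: "1 \<le> k"
  defines "f \<equiv> \<lambda>B. if 1 \<in> B then insert (Suc k) B else B"
  shows "f ` \<sigma> \<in> NC_on {1..Suc k}" "\<exists>B\<in>f ` \<sigma>. 1 \<in> B \<and> Suc k \<in> B"
proof -
  have "1 \<in> \<Union>\<sigma>" using NC_onD(3)[OF \<sigma>] k by simp
  then obtain B where B: "B \<in> \<sigma>" "1 \<in> B" by blast
  then have fB: "f B = insert (Suc k) B" by (simp add: f_def)
  then show "\<exists>B\<in>f ` \<sigma>. 1 \<in> B \<and> Suc k \<in> B" using B by blast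
  have fV: "f V = V" if "V \<in> \<sigma>" "V \<noteq> B" for V
    using NC_on_block_eq[OF \<sigma> that(1) B(1)] B that by (auto simp: f_def)
  have le: "x \<in> {1..k}" if "x \<in> V" "V \<in> \<sigma>" for x V using NC_onD(3)[OF \<sigma>] that by blast
  have "partition_on {1..Suc k} (f ` \<sigma>)"
  proof (rule partition_onI)
    have "\<Union> (f ` \<sigma>) \<subseteq> insert (Suc k) (\<Union>\<sigma>)" by (auto simp: f_def split: if_splits)
    moreover have "V \<subseteq> f V" for V by (auto simp: f_def)
    then have "\<Union>\<sigma> \<subseteq> \<Union> (f ` \<sigma>)" by blast
    moreover have "Suc k \<in> \<Union> (f ` \<sigma>)" using B fB by blast
    ultimately have "\<Union> (f ` \<sigma>) = insert (Suc k) (\<Union>\<sigma>)" by blast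
    also have "\<dots> = {1..Suc k}" using NC_onD(3)[OF \<sigma>] by auto
    finally show "\<Union> (f ` \<sigma>) = {1..Suc k}" .
    show "{} \<notin> f ` \<sigma>" using NC_onD(4)[OF \<sigma>] by (auto simp: f_def split: if_splits)
    fix p q assume "p \<in> f ` \<sigma>" "q \<in> f ` \<sigma>" "p \<noteq> q"
    then obtain V W where VW: "V \<in> \<sigma>" "W \<in> \<sigma>" "V \<noteq> W" "p = f V" "q = f W" by blast
    have "disjnt V W" using NC_on_block_eq[OF \<sigma> VW(1,2)] VW(3) unfolding disjnt_iff by blast
    moreover have "Suc k \<notin> V" "Suc k \<notin> W" using le[of "Suc k"] VW(1,2) by auto
    ultimately show "disjnt p q"
    proof -
      have "f V \<subseteq> insert (Suc k) V" "f W \<subseteq> insert (Suc k) W" by (auto simp: f_def)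
      moreover have "f V = V \<or> f W = W" using fV VW(1-3) by blast
      ultimately show ?thesis
        using \<open>disjnt V W\<close> \<open>Suc k \<notin> V\<close> \<open>Suc k \<notin> W\<close> VW(4,5) unfolding disjnt_iff by blast
    qed
  qed
  moreover have "noncrossing (f ` \<sigma>)"
  proof (rule noncrossingI)
    fix V W a b c d
    assume VW: "V \<in> f ` \<sigma>" "W \<in> f ` \<sigma>"
      and l: "a < b" "b < c" "c < d" and m: "a \<in> V" "c \<in> V" "b \<in> W" "d \<in> W"
    obtain V' W' where V': "V' \<in> \<sigma>" "V = f V'" and W': "W' \<in> \<sigma>" "W = f W'" using VW by blast
    have mem: "x \<in> U" if "U \<in> \<sigma>" "x \<in> f U" "x < Suc k" for x U
      using that by (auto simp: f_def split: if_splits)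
    have "d \<le> Suc k"
      using le[of d] W' m(4) by (fastforce simp: f_def split: if_splits)
    then have abc: "a \<in> V'" "c \<in> V'" "b \<in> W'" using V' W' m l by (auto intro!: mem)
    show "V = W"
    proof (cases "d \<in> W'")
      case True
      then show ?thesis using noncrossingD[OF NC_onD(2)[OF \<sigma>] V'(1) W'(1) l abc(1,2,3)] V' W' by simp
    next
      case False
      then have "W' = B" using fV[of W'] W' m by auto
      show ?thesis
      proof (cases "a = 1")
        case True
        then have "V' = B" using NC_on_block_eq[OF \<sigma> V'(1) B(1)] abc B by blast
        then show ?thesis using \<open>W' = B\<close> V' W' by simp
      next
        case False
        then have "1 < a" using le[OF abc(1) V'(1)] by simp
        then have "W' = V'"
          using noncrossingD[OF NC_onD(2)[OF \<sigma>] W'(1) V'(1), of 1 a b c] l abc B \<open>W' = B\<close> by blast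
        then show ?thesis using V' W' by simp
      qed
    qed
  qed
  ultimately show "f ` \<sigma> \<in> NC_on {1..Suc k}" by (simp add: NC_on_def)
qed

lemma card_NC_same_block:
  assumes "1 \<le> k"
  shows "card {\<sigma>\<in>NC_on {1..Suc k}. \<exists>B\<in>\<sigma>. 1 \<in> B \<and> Suc k \<in> B} = card (NC k)"
proof -
  let ?r = "\<lambda>B. B - {Suc k}" and ?f = "\<lambda>B. if 1 \<in> B then insert (Suc k) B else B"
  have "bij_betw (image ?r) {\<sigma>\<in>NC_on {1..Suc k}. \<exists>B\<in>\<sigma>. 1 \<in> B \<and> Suc k \<in> B} (NC_on {1..k})"
  proof (rule bij_betw_byWitness[where f' = "image ?f"])
    show "\<forall>\<sigma>\<in>{\<sigma>\<in>NC_on {1..Suc k}. \<exists>B\<in>\<sigma>. 1 \<in> B \<and> Suc k \<in> B}. ?f ` ?r ` \<sigma> = \<sigma>"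
    proof clarify
      fix \<sigma> B assume \<sigma>: "\<sigma> \<in> NC_on {1..Suc k}" and B: "B \<in> \<sigma>" "1 \<in> B" "Suc k \<in> B"
      have "?f (?r V) = V" if "V \<in> \<sigma>" for V
        using NC_on_block_eq[OF \<sigma> that B(1)] B assms by (cases "V = B") auto
      then have "(\<lambda>V. ?f (?r V)) ` \<sigma> = (\<lambda>V. V) ` \<sigma>" by (rule image_cong[OF refl])
      then show "?f ` ?r ` \<sigma> = \<sigma>" by (simp only: image_image image_ident)
    qed
    show "\<forall>\<sigma>\<in>NC_on {1..k}. ?r ` ?f ` \<sigma> = \<sigma>"
    proof
      fix \<sigma> assume \<sigma>: "\<sigma> \<in> NC_on {1..k}"
      have "?r (?f V) = V" if "V \<in> \<sigma>" for V
      proof -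
        have "V \<subseteq> {1..k}" using NC_onD(3)[OF \<sigma>] that by blast
        then have "Suc k \<notin> V" by auto
        then show ?thesis by auto
      qed
      then have "(\<lambda>V. ?r (?f V)) ` \<sigma> = (\<lambda>V. V) ` \<sigma>" by (rule image_cong[OF refl])
      then show "?r ` ?f ` \<sigma> = \<sigma>" by (simp only: image_image image_ident)
    qed
    show "image ?r ` {\<sigma>\<in>NC_on {1..Suc k}. \<exists>B\<in>\<sigma>. 1 \<in> B \<and> Suc k \<in> B} \<subseteq> NC_on {1..k}"
      using NC_on_remove_max assms by blast
    show "image ?f ` NC_on {1..k} \<subseteq> {\<sigma>\<in>NC_on {1..Suc k}. \<exists>B\<in>\<sigma>. 1 \<in> B \<and> Suc k \<in> B}"
      using NC_on_insert_max[OF _ assms] by blast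
  qed
  from bij_betw_same_card[OF this] show ?thesis by (simp add: NC_eq_NC_on)
qed

lemma bij_betw_unit_family: "bij_betw (\<lambda>g. g ()) {g. P (g ())} {x. P x}"
  by (rule bij_betw_byWitness[where f' = "\<lambda>x _. x"]) auto

lemma bij_betw_bool_family:
  "bij_betw (\<lambda>g. (g False, g True)) {g. \<forall>i. g i \<in> X} (X \<times> X)"
  by (rule bij_betw_byWitness[where f' = "\<lambda>(x, y) b. if b then y else x"])
    (auto simp: fun_eq_iff split: if_splits)

lemma NC_on_singleton: "NC_on {x} = {{{x}}}"
proof -
  have "\<sigma> = {{x}}" if "partition_on {x} \<sigma>" for \<sigma>
  proof -
    have "B = {x}" if "B \<in> \<sigma>" for B
    proof -
      have "B \<subseteq> {x}" "B \<noteq> {}" using \<open>partition_on {x} \<sigma>\<close> that by (auto simp: partition_on_def)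
      then show ?thesis by blast
    qed
    moreover have "\<sigma> \<noteq> {}" using \<open>partition_on {x} \<sigma>\<close> by (auto simp: partition_on_def)
    ultimately show ?thesis by blast
  qed
  moreover have "partition_on {x} {{x}}" "noncrossing {{x}}"
    by (auto simp: partition_on_space noncrossing_def)
  ultimately have "\<sigma> \<in> NC_on {x} \<longleftrightarrow> \<sigma> = {{x}}" for \<sigma>
    unfolding NC_on_def mem_Collect_eq by metis
  then show ?thesis by (intro set_eqI) (simp only: singleton_iff)
qed

lemma card_NC_0: "card (NC 0) = 1"
  by (simp add: NC_eq_NC_on NC_on_empty)

lemma card_irreducible_unit:
  assumes "1 \<le> k"
  shows "card (irreducible_fam 1 k :: (unit \<Rightarrow> _) set) = card (NC (k - 1))"
proof -
  have "card (irreducible_fam 1 k :: (unit \<Rightarrow> _) set) =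
    card {\<sigma>. \<sigma> \<in> NC_on {1..k} \<and> (\<forall>j\<in>{1..<k}. \<not> saturated {1..j} \<sigma>)}"
    using bij_betw_same_card[OF bij_betw_unit_family[of "\<lambda>\<sigma>. \<sigma> \<in> NC_on {1..k} \<and> (\<forall>j\<in>{1..<k}. \<not> saturated {1..j} \<sigma>)"]]
    by (simp add: irreducible_fam_def NC_fam_def UNIV_unit)
  also have "{\<sigma>. \<sigma> \<in> NC_on {1..k} \<and> (\<forall>j\<in>{1..<k}. \<not> saturated {1..j} \<sigma>)} =
    {\<sigma>\<in>NC_on {1..k}. \<exists>B\<in>\<sigma>. 1 \<in> B \<and> k \<in> B}"
    using irreducible_iff_same_block[OF _ assms] by (intro Collect_cong conj_cong refl)
  also have "card \<dots> = card (NC (k - 1))"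
  proof (cases "k = 1")
    \<comment> \<open>Here 1 is also the maximum and deleting it would empty its block, so this case
      is counted directly; it matches the single partition of the empty set.\<close>
    case True
    then have "{\<sigma>\<in>NC_on {1..k}. \<exists>B\<in>\<sigma>. 1 \<in> B \<and> k \<in> B} = {{{1}}}"
      by (auto simp: NC_on_singleton)
    then show ?thesis using True by (simp add: card_NC_0)
  next
    case False
    then obtain k' where "k = Suc k'" "1 \<le> k'" using assms by (cases k) auto
    then show ?thesis using card_NC_same_block[of k'] by simp
  qed
  finally show ?thesis .
qed

lemma card_NC_Suc: "card (NC (Suc n)) = (\<Sum>i\<le>n. card (NC i) * card (NC (n - i)))"
proof -
  have "card (NC (Suc n)) = (\<Sum>k=1..Suc n. card (NC (k - 1)) * card (NC (Suc n - k)))"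
    using NC_fam_first_return[of "Suc n", where ?'i = unit] card_irreducible_unit by simp
  also have "\<dots> = (\<Sum>i\<le>n. card (NC i) * card (NC (n - i)))"
    by (rule sum.reindex_bij_witness[where i = Suc and j = "\<lambda>k. k - 1"]) auto
  finally show ?thesis .
qed

text \<open>A partition is the least upper bound of the family consisting of itself alone.\<close>

lemma card_NC_elem:
  assumes "\<sigma> \<in> NC_on {1..n}"
  shows "card \<sigma> = card {a\<in>{1..n}. \<exists>b\<in>{a..n}. saturated {a..b} \<sigma>}"
  using card_join[OF assms, of "\<lambda>_::unit. \<sigma>"] assms by (auto simp: refines_refl NC_onD)

text \<open>The Catalan convolution is symmetric under i -> m - i, where n = m + 1. Adding the sum
  to its reflection turns the weights into (m + 1 - i) + (i + 1) = n + 1.\<close>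

lemma sum_card_NC:
  assumes "n \<ge> 1"
  shows "2 * (\<Sum>\<sigma>\<in>NC n. card \<sigma>) = (n + 1) * card (NC n)"
proof -
  obtain m where Suc: "n = Suc m" using assms by (cases n) auto
  have bij: "bij_betw (\<lambda>g. g ()) (NC_fam {1..n} :: (unit \<Rightarrow> _) set) (NC n)"
    using bij_betw_unit_family[of "\<lambda>\<sigma>. \<sigma> \<in> NC_on {1..n}"]
    by (simp add: NC_fam_def UNIV_unit NC_eq_NC_on)
  have "(\<Sum>\<sigma>\<in>NC n. card \<sigma>) = (\<Sum>g\<in>(NC_fam {1..n} :: (unit \<Rightarrow> _) set). card (g ()))"
    by (rule sum.reindex_bij_betw[OF bij, symmetric])
  also have "\<dots> = (\<Sum>g\<in>(NC_fam {1..n} :: (unit \<Rightarrow> _) set). card {a\<in>{1..n}. \<exists>b\<in>{a..n}. sat_fam {a..b} g})"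
    by (intro sum.cong refl, subst card_NC_elem[of _ n]) (auto simp: NC_fam_def UNIV_unit)
  also have "\<dots> = (\<Sum>k=1..n. (Suc n - k) * (card (NC (k - 1)) * card (NC (n - k))))"
    unfolding sum_saturated_starts by (intro sum.cong refl) (simp add: card_irreducible_unit[unfolded One_nat_def])
  also have "\<dots> = (\<Sum>i\<le>m. (Suc m - i) * (card (NC i) * card (NC (m - i))))"
    using Suc by (intro sum.reindex_bij_witness[where i = Suc and j = "\<lambda>k. k - 1"]) auto
  finally have 1: "(\<Sum>\<sigma>\<in>NC n. card \<sigma>) = (\<Sum>i\<le>m. (Suc m - i) * (card (NC i) * card (NC (m - i))))" .
  also have "\<dots> = (\<Sum>i\<le>m. Suc i * (card (NC i) * card (NC (m - i))))"
    by (rule sum.reindex_bij_witness[where i = "\<lambda>i. m - i" and j = "\<lambda>i. m - i"]) (auto simp: Suc_diff_le mult.commute)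
  finally have "2 * (\<Sum>\<sigma>\<in>NC n. card \<sigma>) = (\<Sum>i\<le>m. (Suc m - i) * (card (NC i) * card (NC (m - i))))
     + (\<Sum>i\<le>m. Suc i * (card (NC i) * card (NC (m - i))))"
    using 1 by simp
  also have "\<dots> = (\<Sum>i\<le>m. (n + 1) * (card (NC i) * card (NC (m - i))))"
    unfolding sum.distrib[symmetric]
  proof (rule sum.cong[OF refl])
    fix i assume "i \<in> {..m}"
    then have "Suc m - i + Suc i = n + 1" using Suc by simp
    then show "(Suc m - i) * (card (NC i) * card (NC (m - i))) + Suc i * (card (NC i) * card (NC (m - i)))
       = (n + 1) * (card (NC i) * card (NC (m - i)))"
      by (metis add_mult_distrib)
  qed
  also have "\<dots> = (n + 1) * card (NC n)"
    using Suc by (simp add: card_NC_Suc sum_distrib_left)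
  finally show ?thesis .
qed

lemma sum_card_NC_join:
  "(\<Sum>\<sigma>\<in>NC n. \<Sum>\<rho>\<in>NC n. card (NC_join n \<sigma> \<rho>)) =
    (\<Sum>k=1..n. (Suc n - k) * (card (irreducible_fam 1 k :: (bool \<Rightarrow> _) set) * (card (NC (n - k)))\<^sup>2))"
proof -
  have bij: "bij_betw (\<lambda>g. (g False, g True)) (NC_fam {1..n}) (NC n \<times> NC n)"
    unfolding NC_fam_def NC_eq_NC_on by (rule bij_betw_bool_family)
  have eq: "card (NC_join n (g False) (g True)) = card {a\<in>{1..n}. \<exists>b\<in>{a..n}. sat_fam {a..b} g}"
    if "g \<in> NC_fam {1..n}" for g
  proof (rule card_join)
    have join: "is_NC_join n (g False) (g True) (NC_join n (g False) (g True))"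
      using that by (intro NC_join_is_join) (auto simp: NC_fam_def NC_eq_NC_on)
    then show "NC_join n (g False) (g True) \<in> NC_on {1..n}" by (simp add: is_NC_join_def NC_eq_NC_on)
    show "refines {1..n} (g i) (NC_join n (g False) (g True))" for i
      using join by (cases i) (auto simp: is_NC_join_def)
    show "refines {1..n} (NC_join n (g False) (g True)) \<upsilon>"
      if "\<upsilon> \<in> NC_on {1..n}" "\<And>i. refines {1..n} (g i) \<upsilon>" for \<upsilon>
      using join that by (auto simp: is_NC_join_def NC_eq_NC_on)
  qed
  have "(\<Sum>\<sigma>\<in>NC n. \<Sum>\<rho>\<in>NC n. card (NC_join n \<sigma> \<rho>)) =
    (\<Sum>p\<in>NC n \<times> NC n. card (NC_join n (fst p) (snd p)))"
    by (simp add: sum.cartesian_product case_prod_unfold)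
  also have "\<dots> = (\<Sum>g\<in>NC_fam {1..n}. card (NC_join n (g False) (g True)))"
    using sum.reindex_bij_betw[OF bij, of "\<lambda>p. card (NC_join n (fst p) (snd p))"] by simp
  also have "\<dots> = (\<Sum>g\<in>(NC_fam {1..n} :: (bool \<Rightarrow> _) set). card {a\<in>{1..n}. \<exists>b\<in>{a..n}. sat_fam {a..b} g})"
    by (intro sum.cong refl eq)
  finally show ?thesis unfolding sum_saturated_starts by simp
qed

section \<open>Catalan numbers\<close>

lemma Cat_0: "Cat 0 = 1"
  by (simp add: Cat_def)

lemma Cat_pos: "Cat n > 0"
  by (simp add: Cat_def)

lemma Cat_Suc: "real (n + 2) * Cat (Suc n) = real (4 * n + 2) * Cat n"
proof -
  define F G where "F = (fact n :: real)" and "G = (fact (2 * n) :: real)"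
  have F: "F > 0" by (simp add: F_def)
  have "fact (2 * Suc n) = (2 * real n + 2) * (2 * real n + 1) * G"
    by (simp add: G_def fact_Suc algebra_simps)
  moreover have "(fact (Suc n) :: real) = (real n + 1) * F" "(fact (Suc n + 1) :: real) = (real n + 2) * (real n + 1) * F"
    by (simp_all add: F_def fact_Suc algebra_simps)
  ultimately have C1: "Cat (Suc n) = (2 * real n + 2) * (2 * real n + 1) * G / ((real n + 1) * F * ((real n + 2) * (real n + 1) * F))"
    by (simp only: Cat_def)
  have C2: "Cat n = G / (F * ((real n + 1) * F))"
    by (simp add: Cat_def F_def G_def add.commute)
  show ?thesis unfolding C1 C2 using F
    by (simp add: divide_simps) (simp add: algebra_simps)
qed

text \<open>The convolution says F = 1 + z F^2. Completing the square makes this quadratic equation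
  accessible to a linear differential equation, whose recurrence is the one in
  \<open>Cat_Suc\<close>.\<close>

lemma Catalan_convolution_unique:
  fixes c :: "nat \<Rightarrow> real"
  assumes c0: "c 0 = 1" and cS: "\<And>n. c (Suc n) = (\<Sum>i\<le>n. c i * c (n - i))"
  shows "c n = Cat n"
proof -
  define F where "F = Abs_fps c"
  have F: "F = 1 + fps_X * F * F"
  proof (rule fps_ext)
    fix n
    show "fps_nth F n = fps_nth (1 + fps_X * F * F) n"
    proof (cases n)
      case 0
      then show ?thesis by (simp add: F_def c0)
    next
      case (Suc m)
      have "fps_nth (1 + fps_X * (F * F)) (Suc m) = fps_nth (F * F) m" by simp
      also have "\<dots> = c (Suc m)" by (simp add: F_def cS fps_mult_nth atMost_atLeast0)
      finally show ?thesis using Suc by (simp add: F_def mult.assoc)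
    qed
  qed
  \<comment> \<open>the square root \<open>D\<close> of \<open>1 - 4 z\<close> solves \<open>(1 - 4 z) D' = - 2 D\<close>, a two-term recurrence\<close>
  define D where "D = 1 - 2 * fps_X * F"
  have "D * D = 1 - 4 * fps_X * (F - fps_X * F * F)"
    by (simp add: D_def algebra_simps)
  also have "F - fps_X * F * F = 1" using F by (simp add: algebra_simps)
  finally have DD: "D * D = 1 - 4 * fps_X" by simp
  have "fps_deriv (D * D) = - 4"
    unfolding DD by (simp add: fps_deriv_mult)
  then have "2 * (D * fps_deriv D) = 2 * (- 2)" by (simp add: mult.commute)
  then have D2: "D * fps_deriv D = - 2" by (subst (asm) mult_left_cancel) auto
  have "(1 - 4 * fps_X) * fps_deriv D = D * (D * fps_deriv D)"
    unfolding DD[symmetric] by (simp add: mult.assoc)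
  also have "\<dots> = - 2 * D" unfolding D2 by simp
  finally have ode: "fps_deriv D - 4 * (fps_X * fps_deriv D) = - 2 * D" by (simp add: algebra_simps)
  \<comment> \<open>Because of this shift, the coefficient of the differential equation at
    \<open>Suc k\<close> relates c (k + 1) to c k.\<close>
  have D_Suc: "fps_nth D (Suc k) = - 2 * c k" for k
    by (simp add: D_def F_def mult.assoc numeral_fps_const)
  have rec: "real (k + 2) * c (Suc k) = real (4 * k + 2) * c k" for k
  proof -
    have "fps_nth (fps_deriv D - 4 * (fps_X * fps_deriv D)) (Suc k) = fps_nth (- 2 * D) (Suc k)"
      by (simp only: ode)
    then show ?thesis by (simp add: numeral_fps_const D_Suc algebra_simps flip: fps_const_neg)
  qed
  show ?thesis
  proof (induction n)
    case 0
    show ?case by (simp add: c0 Cat_0)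
  next
    case (Suc k)
    have "real (k + 2) * c (Suc k) = real (k + 2) * Cat (Suc k)"
      unfolding rec Cat_Suc Suc.IH ..
    then show ?case by simp
  qed
qed

section \<open>Convolution with a regular sequence\<close>

text \<open>Tannery's theorem applies to the terms with \<open>k \<le> n / 2\<close>; the others add up to \<open>O(1 / n)\<close>.\<close>
lemma convolution_ratio_tendsto:
  fixes u a :: "nat \<Rightarrow> real"
  assumes u0: "\<And>k. 0 \<le> u k" and u: "\<And>k. u k \<le> K / real (Suc k) ^ 3"
    and c: "c > 0" and a_lower: "\<And>n. n \<ge> 1 \<Longrightarrow> c / real n ^ 2 \<le> a n"
    and a_pos: "\<And>n. a n > 0"
    and a_upper: "\<And>n. a n \<le> K / real (Suc n) ^ 2"
    and ratio: "(\<lambda>n. a n / a (Suc n)) \<longlonglongrightarrow> 1"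
  shows "(\<lambda>n. (\<Sum>k\<le>n. u k * a (n - k)) / a n) \<longlonglongrightarrow> suminf u"
proof -
  have K: "K > 0" using a_pos[of 0] a_upper[of 0] by simp
  have sum2: "summable (\<lambda>n. K / real (Suc n) ^ 2)"
    using summable_mult[OF iffD2[OF summable_Suc_iff inverse_power_summable[of 2, where ?'a = real]], of K]
    by (simp add: divide_inverse)
  have sum3: "summable (\<lambda>n. K / real (Suc n) ^ 3)"
    using summable_mult[OF iffD2[OF summable_Suc_iff inverse_power_summable[of 3, where ?'a = real]], of K]
    by (simp add: divide_inverse)
  have sum_u: "summable u"
    by (rule summable_comparison_test'[OF sum3, of 0]) (use u0 u in auto)
  have shift: "(\<lambda>n. a n / a (n + k)) \<longlonglongrightarrow> 1" for k
  proof (induction k)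
    case 0
    have "a n / a n = 1" for n using a_pos[of n] by simp
    then show ?case by simp
  next
    case (Suc k)
    have "(\<lambda>n. a n / a (n + k) * (a (n + k) / a (Suc (n + k)))) \<longlonglongrightarrow> 1 * 1"
      by (intro tendsto_mult Suc LIMSEQ_ignore_initial_segment[OF ratio])
    moreover have "a n / a (n + k) * (a (n + k) / a (Suc (n + k))) = a n / a (n + Suc k)" for n
    proof -
      have "a (n + k) \<noteq> 0" using a_pos[of "n + k"] by simp
      then show ?thesis by simp
    qed
    ultimately show ?case by (simp only: mult_1)
  qed
  have quot: "(\<lambda>n. a (n - k) / a n) \<longlonglongrightarrow> 1" for k
    by (rule LIMSEQ_offset[of _ k]) (use shift[of k] in simp)
  \<comment> \<open>For 2 k <= n one has n - k + 1 >= n / 2, so a (n - k) / a n <= 4 K / c uniformly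
    in n; this makes 4 K / c * u k a summable dominating sequence.\<close>
  define f where "f k n = (if 2 * k \<le> n then u k * (a (n - k) / a n) else 0)" for k n
  have f_lim: "(\<lambda>n. f k n) \<longlonglongrightarrow> u k" for k
  proof (rule Lim_transform_eventually)
    show "(\<lambda>n. u k * (a (n - k) / a n)) \<longlonglongrightarrow> u k"
      using tendsto_mult[OF tendsto_const[of "u k"] quot[of k]] by simp
    show "\<forall>\<^sub>F n in sequentially. u k * (a (n - k) / a n) = f k n"
      using eventually_ge_at_top[of "2 * k"] by eventually_elim (simp add: f_def)
  qed
  have f_bound: "norm (f k n) \<le> 4 * K / c * u k" if n: "n \<ge> 1" for k n
  proof (cases "2 * k \<le> n")
    case True
    have n0: "real n > 0" using n by simp
    have "real n / 2 \<le> real (Suc (n - k))" using True by (simp add: of_nat_diff)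
    then have "(real n / 2) ^ 2 \<le> real (Suc (n - k)) ^ 2" by (intro power_mono) auto
    then have "K / real (Suc (n - k)) ^ 2 \<le> K / (real n / 2) ^ 2"
      using K n0 by (intro divide_left_mono) auto
    then have "a (n - k) \<le> K / (real n / 2) ^ 2" using a_upper[of "n - k"] by linarith
    then have "a (n - k) / a n \<le> (K / (real n / 2) ^ 2) / (c / real n ^ 2)"
      using a_lower[OF n] a_pos[of n] a_pos[of "n - k"] c n0 K by (intro frac_le) auto
    also have "\<dots> = 4 * K / c" using n0 c by (simp add: field_simps power2_eq_square)
    finally have "u k * (a (n - k) / a n) \<le> u k * (4 * K / c)" using u0 by (intro mult_left_mono) auto
    moreover have "0 \<le> u k * (a (n - k) / a n)" using u0 a_pos by (simp add: less_imp_le)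
    ultimately show ?thesis using True by (simp add: f_def mult.commute)
  next
    case False
    then show ?thesis using u0 K c by (simp add: f_def)
  qed
  have "((\<lambda>n. \<Sum>k. f k n) \<longlonglongrightarrow> suminf u)"
  proof (rule tannerys_theorem[of f u sequentially "\<lambda>k. 4 * K / c * u k", THEN conjunct2, THEN conjunct2])
    show "\<forall>\<^sub>F (k, n) in sequentially \<times>\<^sub>F sequentially. norm (f k n) \<le> 4 * K / c * u k"
    proof -
      have "\<forall>\<^sub>F p in sequentially \<times>\<^sub>F sequentially. snd p \<ge> (1::nat)"
        using eventually_ge_at_top by (rule eventually_prodI[of "\<lambda>_. True", simplified])
      then show ?thesis
        by eventually_elim (use f_bound in auto)
    qed
    show "summable (\<lambda>k. 4 * K / c * u k)" using sum_u by (rule summable_mult)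
  qed (use f_lim in auto)
  moreover have "(\<Sum>k. f k n) = (\<Sum>k\<in>{k. 2 * k \<le> n}. u k * (a (n - k) / a n))" for n
  proof -
    have "finite {k. 2 * k \<le> n}" by (rule finite_subset[of _ "{..n}"]) auto
    then show ?thesis by (subst suminf_finite[of "{k. 2 * k \<le> n}"]) (auto simp: f_def)
  qed
  ultimately have main: "(\<lambda>n. \<Sum>k\<in>{k. 2 * k \<le> n}. u k * (a (n - k) / a n)) \<longlonglongrightarrow> suminf u" by simp
  define S where "S = (\<Sum>n. K / real (Suc n) ^ 2)"
  define R where "R n = (\<Sum>k\<in>{k. n < 2 * k \<and> k \<le> n}. u k * (a (n - k) / a n))" for n
  have "R \<longlonglongrightarrow> 0"
  proof (rule tendsto_sandwich[of "\<lambda>_. 0" _ _ "\<lambda>n. 8 * K * S / c * (1 / real n)"])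
    show "\<forall>\<^sub>F n in sequentially. 0 \<le> R n"
      unfolding R_def using u0 a_pos by (intro always_eventually allI sum_nonneg) (simp add: less_imp_le)
    show "\<forall>\<^sub>F n in sequentially. R n \<le> 8 * K * S / c * (1 / real n)"
      using eventually_ge_at_top[of 1]
    proof eventually_elim
      case (elim n)
      then have n0: "real n > 0" by simp
      have fin: "finite {k. n < 2 * k \<and> k \<le> n}" by (rule finite_subset[of _ "{..n}"]) auto
      \<comment> \<open>Here u k is small: k + 1 >= n / 2 gives u k <= 8 K / n^3, and dividing by a
        n >= c / n^2 leaves one factor 1 / n. The remaining sum of a (n - k) is bounded by
        \<open>S\<close>.\<close>
      have tail: "u k * (a (n - k) / a n) \<le> 8 * K / (c * real n) * a (n - k)" if "n < 2 * k" for k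
      proof -
        have "real n / 2 \<le> real (Suc k)" using that by simp
        then have "(real n / 2) ^ 3 \<le> real (Suc k) ^ 3" by (intro power_mono) auto
        then have "K / real (Suc k) ^ 3 \<le> K / (real n / 2) ^ 3"
          using K n0 by (intro divide_left_mono) auto
        then have uk: "u k \<le> K / (real n / 2) ^ 3" using u[of k] by linarith
        have "u k / a n \<le> (K / (real n / 2) ^ 3) / (c / real n ^ 2)"
          using uk a_lower[OF elim] c n0 K u0 by (intro frac_le) auto
        also have "\<dots> = 8 * K / (c * real n)"
          using n0 c by (simp add: field_simps power2_eq_square power3_eq_cube)
        finally show ?thesis
          using mult_right_mono[of "u k / a n" "8 * K / (c * real n)" "a (n - k)"] a_pos[of "n - k"] by simp
      qed
      have "R n \<le> (\<Sum>k\<in>{k. n < 2 * k \<and> k \<le> n}. 8 * K / (c * real n) * a (n - k))"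
        unfolding R_def using tail by (intro sum_mono) auto
      also have "\<dots> \<le> (\<Sum>k\<le>n. 8 * K / (c * real n) * a (n - k))"
        using K c n0 a_pos by (intro sum_mono2) (auto simp: less_imp_le)
      also have "\<dots> = (\<Sum>k\<le>n. 8 * K / (c * real n) * a k)"
        by (rule sum.reindex_bij_witness[where i = "\<lambda>k. n - k" and j = "\<lambda>k. n - k"]) auto
      also have "\<dots> = 8 * K / (c * real n) * (\<Sum>k\<le>n. a k)" by (simp add: sum_distrib_left)
      also have "(\<Sum>k\<le>n. a k) \<le> (\<Sum>k\<le>n. K / real (Suc k) ^ 2)" by (intro sum_mono a_upper)
      also have "\<dots> \<le> S"
        unfolding S_def using K by (intro sum_le_suminf sum2) auto
      finally show ?case using K c n0 by (simp add: mult_left_mono field_simps)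
    qed
    show "(\<lambda>n. 8 * K * S / c * (1 / real n)) \<longlonglongrightarrow> 0"
      using tendsto_mult[OF tendsto_const[of "8 * K * S / c"] lim_1_over_n] by simp
  qed auto
  from tendsto_add[OF main this]
  have "(\<lambda>n. (\<Sum>k\<in>{k. 2 * k \<le> n}. u k * (a (n - k) / a n)) + R n) \<longlonglongrightarrow> suminf u" by simp
  moreover have "(\<Sum>k\<in>{k. 2 * k \<le> n}. u k * (a (n - k) / a n)) + R n = (\<Sum>k\<le>n. u k * a (n - k)) / a n" for n
  proof -
    have "(\<Sum>k\<in>{k. 2 * k \<le> n}. u k * (a (n - k) / a n)) + R n =
      (\<Sum>k\<in>{k. 2 * k \<le> n} \<union> {k. n < 2 * k \<and> k \<le> n}. u k * (a (n - k) / a n))"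
      unfolding R_def
      by (rule sum.union_disjoint[symmetric]) (auto intro: finite_subset[of _ "{..n}"])
    also have "{k. 2 * k \<le> n} \<union> {k. n < 2 * k \<and> k \<le> n} = {..n}" by auto
    finally show ?thesis by (simp add: sum_divide_distrib)
  qed
  ultimately show ?thesis by simp
qed

section \<open>Squared Catalan numbers at the radius of convergence\<close>

text \<open>The \<open>n\<close>-th term of \<open>(z M(z))'\<close> at the radius of convergence \<open>z = 1/16\<close>, where \<open>M\<close> is the
  generating function of the squared Catalan numbers.\<close>
definition deriv_term :: "nat \<Rightarrow> real" where
  "deriv_term n = real (Suc n) * (Cat n)\<^sup>2 / 16 ^ n"

lemma deriv_term_pos: "deriv_term n > 0"
  using Cat_pos[of n] by (simp add: deriv_term_def)

lemma deriv_term_Suc: "deriv_term (Suc n) = (2 * real n + 1)\<^sup>2 / (4 * (real n + 1) * (real n + 2)) * deriv_term n"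
proof -
  have C: "Cat (Suc n) = (4 * real n + 2) / (real n + 2) * Cat n"
    using Cat_Suc[of n] by (simp add: field_simps)
  define x where "x = (Cat n)\<^sup>2 / 16 ^ n"
  have w1: "deriv_term (Suc n) = (real n + 2) * ((4 * real n + 2) / (real n + 2))\<^sup>2 * x / 16"
    by (simp add: deriv_term_def C x_def power_mult_distrib power_divide add.commute)
  have w0: "deriv_term n = (real n + 1) * x" by (simp add: deriv_term_def x_def add.commute)
  show ?thesis unfolding w1 w0
    by (simp add: divide_simps) (simp add: algebra_simps power2_eq_square)
qed

text \<open>The sequence n^2 * \<open>deriv_term\<close> n increases, and 1/8 is its value at n =
  1.\<close>

lemma deriv_term_lower: "n \<ge> 1 \<Longrightarrow> (1 / 8) / real n ^ 2 \<le> deriv_term n"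
proof (induction n rule: dec_induct)
  case base
  show ?case by (simp add: deriv_term_def Cat_def fact_Suc)
next
  case (step n)
  have n: "real n > 0" using step by simp
  have "1 / 8 \<le> deriv_term n * real n ^ 2" using step n by (simp add: field_simps)
  also have "\<dots> \<le> deriv_term n * ((2 * real n + 1)\<^sup>2 * real (Suc n) ^ 2 / (4 * (real n + 1) * (real n + 2)))"
  proof (rule mult_left_mono)
    show "real n ^ 2 \<le> (2 * real n + 1)\<^sup>2 * real (Suc n) ^ 2 / (4 * (real n + 1) * (real n + 2))"
    proof (subst pos_le_divide_eq)
      have "(2 * real n + 1)\<^sup>2 * real (Suc n) ^ 2 - real n ^ 2 * (4 * (real n + 1) * (real n + 2)) =
        5 * real n ^ 2 + 6 * real n + 1"
        by (simp add: algebra_simps power2_eq_square)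
      moreover have "0 \<le> 5 * real n ^ 2 + 6 * real n + 1" by simp
      ultimately show "real n ^ 2 * (4 * (real n + 1) * (real n + 2)) \<le> (2 * real n + 1)\<^sup>2 * real (Suc n) ^ 2"
        by linarith
    qed (use n in simp)
  qed (use deriv_term_pos[of n] in simp)
  also have "\<dots> = deriv_term (Suc n) * real (Suc n) ^ 2" by (simp add: deriv_term_Suc)
  finally show ?case by (simp add: field_simps)
qed

text \<open>The sequence (n + 1) (n + 2) * \<open>deriv_term\<close> n decreases from its value 2 at
  n = 0; its two factors match the denominator in \<open>deriv_term_Suc\<close>.\<close>

lemma deriv_term_upper: "deriv_term n \<le> 2 / real (Suc n) ^ 2"
proof -
  have "deriv_term n * ((real n + 1) * (real n + 2)) \<le> 2"
  proof (induction n)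
    case 0
    show ?case by (simp add: deriv_term_def Cat_0)
  next
    case (Suc n)
    have "deriv_term (Suc n) * ((real (Suc n) + 1) * (real (Suc n) + 2)) =
      deriv_term n * ((2 * real n + 1)\<^sup>2 * (real n + 3) / (4 * (real n + 1)))"
      unfolding deriv_term_Suc by (simp add: divide_simps) (simp add: algebra_simps)
    also have "\<dots> \<le> deriv_term n * ((real n + 1) * (real n + 2))"
    proof (rule mult_left_mono)
      show "(2 * real n + 1)\<^sup>2 * (real n + 3) / (4 * (real n + 1)) \<le> (real n + 1) * (real n + 2)"
        by (simp add: field_simps power2_eq_square)
    qed (use deriv_term_pos[of n] in simp)
    finally show ?case using Suc by linarith
  qed
  moreover have "deriv_term n * real (Suc n) ^ 2 \<le> deriv_term n * ((real n + 1) * (real n + 2))"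
    using deriv_term_pos[of n] by (intro mult_left_mono) (auto simp: power2_eq_square algebra_simps)
  ultimately show ?thesis by (simp add: field_simps)
qed

lemma inverse_odd_tendsto_0: "(\<lambda>n. 1 / (2 * real n + 1)) \<longlonglongrightarrow> 0"
proof -
  have "strict_mono (\<lambda>n::nat. 2 * n)" by (simp add: strict_mono_def)
  from LIMSEQ_subseq_LIMSEQ[OF LIMSEQ_inverse_real_of_nat this]
  show ?thesis by (simp add: comp_def inverse_eq_divide add.commute)
qed

lemma deriv_term_ratio: "(\<lambda>n. deriv_term n / deriv_term (Suc n)) \<longlonglongrightarrow> 1"
proof -
  have "deriv_term n / deriv_term (Suc n) = (1 + 1 / (2 * real n + 1)) * (1 + 3 * (1 / (2 * real n + 1)))" for n
  proof -
    have "deriv_term n / deriv_term (Suc n) = 4 * (real n + 1) * (real n + 2) / (2 * real n + 1)\<^sup>2"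
      using deriv_term_pos[of n] by (simp add: deriv_term_Suc)
    also have "\<dots> = (2 * (real n + 1) / (2 * real n + 1)) * (2 * (real n + 2) / (2 * real n + 1))"
      by (simp add: power2_eq_square algebra_simps)
    also have "2 * (real n + 1) / (2 * real n + 1) = 1 + 1 / (2 * real n + 1)"
      by (simp add: divide_simps)
    also have "2 * (real n + 2) / (2 * real n + 1) = 1 + 3 * (1 / (2 * real n + 1))"
      by (simp add: divide_simps)
    finally show ?thesis .
  qed
  moreover have "(\<lambda>n. (1 + 1 / (2 * real n + 1)) * (1 + 3 * (1 / (2 * real n + 1)))) \<longlonglongrightarrow> (1 + 0) * (1 + 3 * 0)"
    by (intro tendsto_intros inverse_odd_tendsto_0)
  ultimately show ?thesis by simp
qed

lemma Cat_squared_sums: "(\<lambda>n. (Cat n)\<^sup>2 / 16 ^ n) sums (16 / pi - 4)"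
proof -
  define P where "P n = (\<Prod>k=1..n. (4 * real k ^ 2) / (4 * real k ^ 2 - 1))" for n
  \<comment> \<open>In terms of t_n = binom(2 n, n) / 4^n, (n + 1) * \<open>deriv_term\<close> n is
    t_n^2. So the n-th Wallis product is 1 / ((2 n + 1) t_n^2).\<close>
  have P: "P n * ((2 * real n + 1) * (real n + 1) * deriv_term n) = 1" for n
  proof (induction n)
    case 0
    show ?case by (simp add: P_def deriv_term_def Cat_0)
  next
    case (Suc n)
    have P_Suc: "P (Suc n) = P n * (4 * (real n + 1)\<^sup>2 / ((2 * real n + 1) * (2 * real n + 3)))"
    proof -
      have "4 * real (Suc n) ^ 2 - 1 = (2 * real n + 1) * (2 * real n + 3)"
        by (simp add: power2_eq_square algebra_simps)
      moreover have "P (Suc n) = P n * ((4 * real (Suc n) ^ 2) / (4 * real (Suc n) ^ 2 - 1))"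
        by (simp add: P_def)
      ultimately show ?thesis by (simp add: add.commute)
    qed
    have "P (Suc n) * ((2 * real (Suc n) + 1) * (real (Suc n) + 1) * deriv_term (Suc n)) =
       P n * ((2 * real n + 1) * (real n + 1) * deriv_term n)"
      unfolding deriv_term_Suc P_Suc by (simp add: divide_simps) (simp add: algebra_simps power2_eq_square)
    then show ?case using Suc by simp
  qed
  \<comment> \<open>The subtracted 4 is the value of 4 (4 n + 1) t_n^2 at n = 0.\<close>
  have tele: "(\<Sum>k<n. (Cat k)\<^sup>2 / 16 ^ k) = 4 * (4 * real n + 1) * (real n + 1) * deriv_term n - 4" for n
  proof (induction n)
    case 0
    show ?case by (simp add: deriv_term_def Cat_0)
  next
    case (Suc n)
    have "(Cat n)\<^sup>2 / 16 ^ n = deriv_term n / (real n + 1)" by (simp add: deriv_term_def add.commute)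
    then have "(\<Sum>k<Suc n. (Cat k)\<^sup>2 / 16 ^ k) = 4 * (4 * real n + 1) * (real n + 1) * deriv_term n - 4 + deriv_term n / (real n + 1)"
      using Suc by simp
    also have "\<dots> = 4 * (4 * real (Suc n) + 1) * (real (Suc n) + 1) * deriv_term (Suc n) - 4"
      unfolding deriv_term_Suc by (simp add: divide_simps) (simp add: algebra_simps power2_eq_square)
    finally show ?case .
  qed
  have "(\<Sum>k<n. (Cat k)\<^sup>2 / 16 ^ k) = 4 * ((4 * real n + 1) / (2 * real n + 1)) / P n - 4" for n
  proof -
    have nz: "P n * ((2 * real n + 1) * (real n + 1)) \<noteq> 0" using P[of n] by auto
    have cw: "deriv_term n = 1 / (P n * ((2 * real n + 1) * (real n + 1)))"
      unfolding nonzero_eq_divide_eq[OF nz] using P[of n] by (simp only: mult_ac)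
    have "P n \<noteq> 0" using nz by simp
    then show ?thesis unfolding tele cw by (simp add: divide_simps)
  qed
  \<comment> \<open>Here (4 n + 1) / (2 n + 1) tends to 2 and the Wallis product to pi / 2.\<close>
  moreover have "(\<lambda>n. 4 * ((4 * real n + 1) / (2 * real n + 1)) / P n - 4) \<longlonglongrightarrow> 4 * 2 / (pi / 2) - 4"
  proof (intro tendsto_diff tendsto_divide tendsto_mult tendsto_const)
    have "(4 * real n + 1) / (2 * real n + 1) = 2 - 1 / (2 * real n + 1)" for n
      by (simp add: divide_simps)
    then show "(\<lambda>n. (4 * real n + 1) / (2 * real n + 1)) \<longlonglongrightarrow> 2"
      using tendsto_diff[OF tendsto_const[of 2] inverse_odd_tendsto_0] by simp
    show "P \<longlonglongrightarrow> pi / 2" unfolding P_def by (rule wallis)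
  qed simp
  ultimately show ?thesis by (simp add: sums_def)
qed

section \<open>The mean distance\<close>

lemma card_NC: "real (card (NC n)) = Cat n"
  by (rule Catalan_convolution_unique) (simp_all add: card_NC_0 card_NC_Suc)

text \<open>The \<open>n\<close>-th term of \<open>U(z)\<close> at \<open>z = 1/16\<close>, where \<open>U\<close> is the generating function of the pairs
  not separated by any cut \<open>{1..j}\<close> with \<open>j < n\<close>.\<close>
definition irr_term :: "nat \<Rightarrow> real" where
  "irr_term k = (if k = 0 then 0 else real (card (irreducible_fam 1 k :: (bool \<Rightarrow> _) set)) / 16 ^ k)"

lemma irr_term_nonneg: "0 \<le> irr_term k"
  by (simp add: irr_term_def)

text \<open>The generating function identity \<open>M = 1 + U M\<close>.\<close>
lemma irr_term_convolution:
  "(\<Sum>k\<le>n. irr_term k * ((Cat (n - k))\<^sup>2 / 16 ^ (n - k))) = (Cat n)\<^sup>2 / 16 ^ n - (if n = 0 then 1 else 0)"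
proof (cases "n = 0")
  case True
  then show ?thesis by (simp add: irr_term_def Cat_0)
next
  case False
  have "(Cat n)\<^sup>2 = real (card (NC n) ^ CARD(bool))"
    by (simp add: card_NC)
  also have "\<dots> = (\<Sum>k=1..n. real (card (irreducible_fam 1 k :: (bool \<Rightarrow> _) set)) * (Cat (n - k))\<^sup>2)"
    using False by (subst NC_fam_first_return) (simp_all add: card_NC)
  finally have "(Cat n)\<^sup>2 / 16 ^ n =
      (\<Sum>k=1..n. real (card (irreducible_fam 1 k :: (bool \<Rightarrow> _) set)) * (Cat (n - k))\<^sup>2 / 16 ^ n)"
    by (simp add: sum_divide_distrib)
  also have "\<dots> = (\<Sum>k=1..n. irr_term k * ((Cat (n - k))\<^sup>2 / 16 ^ (n - k)))"
    by (intro sum.cong refl) (auto simp: irr_term_def simp flip: power_add)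
  \<comment> \<open>The empty family would count as irreducible for k = 0; \<open>irr_term\<close> 0
    = 0 excludes it and lets the sum start at 0.\<close>
  also have "\<dots> = (\<Sum>k\<le>n. irr_term k * ((Cat (n - k))\<^sup>2 / 16 ^ (n - k)))"
    by (intro sum.mono_neutral_left) (auto simp: irr_term_def not_less_eq_eq)
  finally show ?thesis using False by simp
qed

text \<open>In M = 1 + U M all terms are nonnegative and M has constant term 1, so each coefficient
  of U is at most that of M. The latter is \<open>deriv_term\<close> k / (k + 1), which gives the
  extra power of k.\<close>

lemma irr_term_le: "irr_term k \<le> 2 / real (Suc k) ^ 3"
proof -
  have "irr_term k * ((Cat (k - k))\<^sup>2 / 16 ^ (k - k)) \<le> (\<Sum>j\<le>k. irr_term j * ((Cat (k - j))\<^sup>2 / 16 ^ (k - j)))"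
    by (rule member_le_sum) (auto simp: irr_term_nonneg)
  then have "irr_term k \<le> (Cat k)\<^sup>2 / 16 ^ k"
    unfolding irr_term_convolution by (simp add: Cat_0 split: if_splits)
  also have "\<dots> = deriv_term k / real (Suc k)" by (simp add: deriv_term_def)
  also have "\<dots> \<le> 2 / real (Suc k) ^ 2 / real (Suc k)"
    by (intro divide_right_mono deriv_term_upper) simp
  finally show ?thesis by (simp add: power3_eq_cube power2_eq_square mult.assoc)
qed

text \<open>Both series converge absolutely at 1/16, so the Cauchy product gives U M = M - 1 there,
  with M = 16 / pi - 4. Since pi < 4, M can be divided out.\<close>

lemma suminf_irr_term: "suminf irr_term = 1 - pi / (16 - 4 * pi)"
proof -
  let ?m = "\<lambda>n. (Cat n)\<^sup>2 / 16 ^ n"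
  have "summable (\<lambda>n. 2 / real (Suc n) ^ 3)"
    using summable_mult[OF iffD2[OF summable_Suc_iff inverse_power_summable[of 3, where ?'a = real]], of 2]
    by (simp add: divide_inverse)
  then have s: "summable (\<lambda>k. norm (irr_term k))"
    by (rule summable_comparison_test') (use irr_term_le irr_term_nonneg in auto)
  have m: "summable (\<lambda>k. norm (?m k))"
    using sums_summable[OF Cat_squared_sums] by simp
  have "(\<lambda>n. ?m n - (if n = 0 then 1 else 0)) sums (suminf irr_term * suminf ?m)"
    using Cauchy_product_sums[OF s m] unfolding irr_term_convolution .
  moreover have "(\<lambda>n. ?m n - (if n = 0 then 1 else 0)) sums (16 / pi - 4 - 1)"
    by (intro sums_diff Cat_squared_sums) (rule sums_single)
  ultimately have "suminf irr_term * suminf ?m = 16 / pi - 4 - 1"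
    by (rule sums_unique2)
  moreover have "suminf ?m = 16 / pi - 4"
    using Cat_squared_sums by (rule sums_unique[symmetric])
  ultimately have "suminf irr_term * (16 / pi - 4) = 16 / pi - 4 - 1" by simp
  moreover have "pi < 4" using pi_less_4 .
  ultimately show ?thesis using pi_gt_zero by (simp add: field_simps)
qed

text \<open>Since 16^n * \<open>deriv_term\<close> n = (n + 1) (Cat n)^2, the total of the join is
  exactly a convolution with \<open>deriv_term\<close>. The block counts of sigma and rho add up to
  (n + 1) (Cat n)^2, which gives the common factor (n + 1) / n.\<close>

lemma mean_distance_eq:
  assumes "n \<ge> 1"
  shows "1 / real n * (1 / (Cat n)\<^sup>2) *
            (\<Sum>\<sigma>\<in>NC n. \<Sum>\<rho>\<in>NC n.
               real (card \<sigma>) + real (card \<rho>) - 2 * real (card (NC_join n \<sigma> \<rho>))) =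
     (real n + 1) / real n * (1 - 2 * ((\<Sum>k\<le>n. irr_term k * deriv_term (n - k)) / deriv_term n))"
proof -
  have n: "real n > 0" using assms by simp
  have single: "2 * (\<Sum>\<sigma>\<in>NC n. real (card \<sigma>)) = (real n + 1) * Cat n"
  proof -
    have "2 * (\<Sum>\<sigma>\<in>NC n. card \<sigma>) = (n + 1) * card (NC n)" using sum_card_NC[OF assms] .
    from arg_cong[OF this, of real] show ?thesis by (simp add: card_NC distrib_right)
  qed
  have join: "(\<Sum>\<sigma>\<in>NC n. \<Sum>\<rho>\<in>NC n. real (card (NC_join n \<sigma> \<rho>))) = 16 ^ n * (\<Sum>k\<le>n. irr_term k * deriv_term (n - k))"
  proof -
    have "(\<Sum>\<sigma>\<in>NC n. \<Sum>\<rho>\<in>NC n. real (card (NC_join n \<sigma> \<rho>))) =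
      (\<Sum>k=1..n. real (Suc n - k) * (real (card (irreducible_fam 1 k :: (bool \<Rightarrow> _) set)) * (Cat (n - k))\<^sup>2))"
      using arg_cong[OF sum_card_NC_join[of n], of real] by (simp add: card_NC)
    also have "\<dots> = (\<Sum>k=1..n. 16 ^ n * (irr_term k * deriv_term (n - k)))"
    proof (rule sum.cong[OF refl])
      fix k assume k: "k \<in> {1..n}"
      then have "(16::real) ^ n = 16 ^ k * 16 ^ (n - k)" by (simp flip: power_add)
      moreover have "Suc n - k = Suc (n - k)" using k by auto
      ultimately show "real (Suc n - k) * (real (card (irreducible_fam 1 k :: (bool \<Rightarrow> _) set)) * (Cat (n - k))\<^sup>2) =
          16 ^ n * (irr_term k * deriv_term (n - k))"
        using k by (simp add: irr_term_def deriv_term_def)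
    qed
    also have "\<dots> = (\<Sum>k\<le>n. 16 ^ n * (irr_term k * deriv_term (n - k)))"
      by (intro sum.mono_neutral_left) (auto simp: irr_term_def not_less_eq_eq)
    finally show ?thesis by (simp add: sum_distrib_left)
  qed
  have "(\<Sum>\<sigma>\<in>NC n. \<Sum>\<rho>\<in>NC n. real (card \<sigma>) + real (card \<rho>) - 2 * real (card (NC_join n \<sigma> \<rho>)))
    = Cat n * (2 * (\<Sum>\<sigma>\<in>NC n. real (card \<sigma>))) - 2 * (\<Sum>\<sigma>\<in>NC n. \<Sum>\<rho>\<in>NC n. real (card (NC_join n \<sigma> \<rho>)))"
    by (simp add: sum.distrib sum_subtractf card_NC flip: sum_distrib_left)
  also have "\<dots> = (real n + 1) * (Cat n)\<^sup>2 - 2 * 16 ^ n * (\<Sum>k\<le>n. irr_term k * deriv_term (n - k))"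
    unfolding single join by (simp add: power2_eq_square)
  finally show ?thesis
    using n Cat_pos[of n] by (simp add: deriv_term_def divide_simps) (simp add: algebra_simps)
qed

lemma mean_distance_tendsto:
  "(\<lambda>n::nat. 1 / real n * (1 / (Cat n)\<^sup>2) *
            (\<Sum>\<sigma>\<in>NC n. \<Sum>\<rho>\<in>NC n.
               real (card \<sigma>) + real (card \<rho>) - 2 * real (card (NC_join n \<sigma> \<rho>))))
           \<longlonglongrightarrow> (3 * pi - 8) / (8 - 2 * pi)"
proof -
  have "(\<lambda>n. (\<Sum>k\<le>n. irr_term k * deriv_term (n - k)) / deriv_term n) \<longlonglongrightarrow> suminf irr_term"
    by (rule convolution_ratio_tendsto[where K = 2 and c = "1 / 8"])
      (use irr_term_nonneg irr_term_le deriv_term_lower deriv_term_pos deriv_term_upper deriv_term_ratio in auto)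
  moreover have "(\<lambda>n. (real n + 1) / real n) \<longlonglongrightarrow> 1"
    using LIMSEQ_Suc_n_over_n[where ?'a = real] by (simp add: add.commute)
  ultimately have "(\<lambda>n. (real n + 1) / real n * (1 - 2 * ((\<Sum>k\<le>n. irr_term k * deriv_term (n - k)) / deriv_term n)))
      \<longlonglongrightarrow> 1 * (1 - 2 * suminf irr_term)"
    by (intro tendsto_mult tendsto_diff tendsto_const)
  also have "1 * (1 - 2 * suminf irr_term) = (3 * pi - 8) / (8 - 2 * pi)"
    unfolding suminf_irr_term using pi_less_4 by (simp add: divide_simps) (simp add: algebra_simps)
  finally show ?thesis
    by (rule Lim_transform_eventually)
      (use eventually_ge_at_top[of 1] in eventually_elim, simp only: mean_distance_eq)
qed

theorem proposition1p4:
  shows "(\<lambda>n::nat. 1 / real n * (1 / (Cat n)\<^sup>2) *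
            (\<Sum>\<sigma>\<in>NC n. \<Sum>\<rho>\<in>NC n.
               real (card \<sigma>) + real (card \<rho>) - 2 * real (card (NC_join n \<sigma> \<rho>))))
           \<longlonglongrightarrow> (3 * pi - 8) / (8 - 2 * pi)
         \<and> (3 * pi - 8) / (8 - 2 * pi) < (0.83 :: real)"
proof
  show "(\<lambda>n::nat. 1 / real n * (1 / (Cat n)\<^sup>2) *
            (\<Sum>\<sigma>\<in>NC n. \<Sum>\<rho>\<in>NC n.
               real (card \<sigma>) + real (card \<rho>) - 2 * real (card (NC_join n \<sigma> \<rho>))))
           \<longlonglongrightarrow> (3 * pi - 8) / (8 - 2 * pi)"
    by (rule mean_distance_tendsto)
  show "(3 * pi - 8) / (8 - 2 * pi) < (0.83 :: real)"
    \<comment> \<open>After clearing the positive denominator the claim is 4.66 pi < 14.64, that is,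
      pi < 3.14163 approximately; the margin is below 4 / 10^5.\<close>
    using pi_approx by (simp add: field_simps)
qed

end
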